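(* For $k\in\mathbb{N}$, the tropical cone $\mathrm{Prob}[\mathbf C_k]$ is isomorphic to the following cone in $(\mathbb{R}^k,|\cdot|_1)$: $$ K_k=\left\{(x_k,\dots,x_1)\in\mathbb{R}^k\ \middle|\ 0\le x_1\le\dots\le x_k\right\}, $$ with the algebraic structure and the pseudo-distance preserved under the isomorphism. That is, there is a surjective map $\Phi:\mathrm{Prob}[\mathbf C_k]\to K_k$ with $\Phi(\bar{\mathcal X}\otimes\bar{\mathcal Y})=\Phi(\bar{\mathcal X})+\Phi(\bar{\mathcal Y})$, $\Phi(\lambda\cdot\bar{\mathcal X})=\lambda\,\Phi(\bar{\mathcal X})$ and $|\Phi(\bar{\mathcal X})-\Phi(\bar{\mathcal Y})|_1=\hat\kappa(\bar{\mathcal X},\bar{\mathcal Y})$ for all $\bar{\mathcal X},\bar{\mathcal Y}\in\mathrm{Prob}[\mathbf C_k]$ and $\lambda\in\mathbb{R}_{\ge0}$.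
   Context: $\mathbb{N}=\{1,2,\dots\}$, $\mathbb{N}_0=\mathbb{N}\cup\{0\}$; $|\cdot|_1$ is the $\ell^1$-norm. Isomorphism is understood for pseudo-metric spaces, i.e. up to identifying points at distance zero. Diagrams. A finite probability space is a set with a probability measure of finite support; its atoms are the points of positive weight, and $\mathrm{Ent}(X)=-\sum_{x}p(x)\ln p(x)$. A reduction is an equivalence class of measure-preserving maps, where maps agreeing on a set of full measure are identified. The chain $\mathbf C_k$ is the category with $k$ objects $O_1,\dots,O_k$ and a (unique) morphism $O_i\to O_j$ whenever $i\ge j$. $\mathrm{Prob}\langle\mathbf C_k\rangle$ is the space of $\mathbf C_k$-diagrams, i.e. chains of reductions $X_k\to X_{k-1}\to\dots\to X_1$ of finite probability spaces; a morphism of such diagrams is a collection of reductions between corresponding spaces commuting with the reductions within the diagrams. The tensor product $\mathcal X\otimes\mathcal Y$ takes products of corresponding probability spaces and Cartesian products of maps; its neutral element is the constant diagram of one-point spaces (isomorphic diagrams are regarded as the same), and $\mathcal X^n$ is the $n$-fold tensor power. $\mathrm{Ent}_*(\mathcal X)=(\mathrm{Ent}(X_k),\dots,\mathrm{Ent}(X_1))\in\mathbb{R}^k$. Distances. For a two-fan $\mathcal F=(\mathcal X\leftarrow\mathcal Z\to\mathcal Y)$ of $\mathbf C_k$-diagrams (two morphisms of diagrams with common source), $\mathrm{kd}(\mathcal F)=|\mathrm{Ent}_*\mathcal Z-\mathrm{Ent}_*\mathcal X|_1+|\mathrm{Ent}_*\mathcal Z-\mathrm{Ent}_*\mathcal Y|_1$.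 The intrinsic entropy distance is $\mathbf{k}(\mathcal X,\mathcal Y)=\inf\{\mathrm{kd}(\mathcal F)\}$ over all two-fans $\mathcal F=(\mathcal X\leftarrow\mathcal Z\to\mathcal Y)$, and $\kappa(\mathcal X,\mathcal Y)=\lim_{n\to\infty}\frac1n\mathbf{k}(\mathcal X^{n},\mathcal Y^{n})$. Both are pseudo-distances for which $\otimes$ is $1$-Lipschitz in each argument. Tropical cone. Let $\phi(t)=t^{3/4}$. $\mathrm{Prob}[\mathbf C_k]=\mathrm{QL}_\phi(\mathrm{Prob}\langle\mathbf C_k\rangle,\kappa)$ is the set of sequences $\bar{\mathcal X}=\{\mathcal X(i)\}_{i\in\mathbb{N}_0}$ in $\mathrm{Prob}\langle\mathbf C_k\rangle$ with $\mathcal X(0)$ the neutral element, for which there is a constant $C\ge0$ (depending on the sequence) with $\kappa(\mathcal X(m+n),\mathcal X(m)\otimes\mathcal X(n))\le C\phi(m+n)$ for all $m,n\in\mathbb{N}$. It carries the element-wise operation $\otimes$ (the addition of the cone), the $\mathbb{R}_{\ge0}$-action $\lambda\cdot\bar{\mathcal X}=\{\mathcal X(\lfloor\lambda n\rfloor)\}_{n\in\mathbb{N}_0}$ (an action up to asymptotic equivalence), and the asymptotic pseudo-distance $\hat\kappa(\bar{\mathcal X},\bar{\mathcal Y})=\lim_{n\to\infty}\frac1n\kappa(\mathcal X(n),\mathcal Y(n))$ (the limit exists and is finite). *)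

theory Defs
  imports "HOL-Probability.Probability"
begin

section \<open>Finite probability spaces and reductions\<close>

text \<open>A finite probability space is a discrete distribution with finite support; its atoms are
  the elements of the support.\<close>

definition finite_space :: "'a pmf \<Rightarrow> bool" where
  "finite_space p \<longleftrightarrow> finite (set_pmf p)"

definition Ent :: "'a pmf \<Rightarrow> real" where
  "Ent p = - (\<Sum>x\<in>set_pmf p. pmf p x * ln (pmf p x))"

text \<open>Reductions are given by representatives: a reduction is a measure-preserving map, and every
  identity between reductions below is required only almost everywhere.\<close>

definition reduction :: "('a \<Rightarrow> 'b) \<Rightarrow> 'a pmf \<Rightarrow> 'b pmf \<Rightarrow> bool" where
  "reduction f p q \<longleftrightarrow> map_pmf f p = q"


section \<open>Chain diagrams\<close>

text \<open>A diagram over the chain with \<open>k\<close> objects consists of spaces \<open>sp X i\<close> for \<open>1 \<le> i \<le> k\<close> and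
  reductions \<open>arr X i\<close> from \<open>sp X (i + 1)\<close> to \<open>sp X i\<close> for \<open>1 \<le> i < k\<close>; the remaining arrows are the
  composites. Values at other indices are irrelevant.

  All spaces have the underlying set \<open>nat\<close>. As reductions are taken modulo null sets, every finite
  probability space is isomorphic to one of these, so nothing is lost up to isomorphism.
  Isomorphic diagrams are not literally equal here: an equation between diagrams becomes
  \<open>diagram_iso\<close>.\<close>

record diagram =
  sp :: "nat \<Rightarrow> nat pmf"
  arr :: "nat \<Rightarrow> nat \<Rightarrow> nat"

definition Prob_chain :: "nat \<Rightarrow> diagram set" where
  "Prob_chain k = {X. (\<forall>i\<in>{1..k}. finite_space (sp X i)) \<and>
                      (\<forall>i\<in>{1..<k}. reduction (arr X i) (sp X (Suc i)) (sp X i))}"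

definition diagram_morphism :: "nat \<Rightarrow> (nat \<Rightarrow> nat \<Rightarrow> nat) \<Rightarrow> diagram \<Rightarrow> diagram \<Rightarrow> bool" where
  "diagram_morphism k h X Y \<longleftrightarrow>
     (\<forall>i\<in>{1..k}. reduction (h i) (sp X i) (sp Y i)) \<and>
     (\<forall>i\<in>{1..<k}. AE x in measure_pmf (sp X (Suc i)). h i (arr X i x) = arr Y i (h (Suc i) x))"

definition diagram_iso :: "nat \<Rightarrow> diagram \<Rightarrow> diagram \<Rightarrow> bool" where
  "diagram_iso k X Y \<longleftrightarrow>
     (\<exists>f g. diagram_morphism k f X Y \<and> diagram_morphism k g Y X \<and>
        (\<forall>i\<in>{1..k}. (AE x in measure_pmf (sp X i). g i (f i x) = x) \<and>
                    (AE y in measure_pmf (sp Y i). f i (g i y) = y)))"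

text \<open>Pairs of points are coded as natural numbers by the bijection \<open>prod_encode\<close>.\<close>

definition tensor :: "diagram \<Rightarrow> diagram \<Rightarrow> diagram" where
  "tensor X Y = \<lparr> sp = (\<lambda>i. map_pmf prod_encode (pair_pmf (sp X i) (sp Y i))),
                  arr = (\<lambda>i z. prod_encode (map_prod (arr X i) (arr Y i) (prod_decode z))) \<rparr>"

definition neutral :: diagram where
  "neutral = \<lparr> sp = (\<lambda>i. return_pmf 0), arr = (\<lambda>i x. 0) \<rparr>"

primrec tensor_power :: "diagram \<Rightarrow> nat \<Rightarrow> diagram" where
  "tensor_power X 0 = neutral"
| "tensor_power X (Suc n) = tensor X (tensor_power X n)"


section \<open>The space of real vectors and the cone\<close>

text \<open>Vectors are functions on \<open>{1..k}\<close>, extended by \<open>undefined\<close>.\<close>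

definition Rvec :: "nat \<Rightarrow> (nat \<Rightarrow> real) set" where
  "Rvec k = {1..k} \<rightarrow>\<^sub>E UNIV"

definition vec_add :: "nat \<Rightarrow> (nat \<Rightarrow> real) \<Rightarrow> (nat \<Rightarrow> real) \<Rightarrow> (nat \<Rightarrow> real)" where
  "vec_add k x y = (\<lambda>i\<in>{1..k}. x i + y i)"

definition vec_scale :: "nat \<Rightarrow> real \<Rightarrow> (nat \<Rightarrow> real) \<Rightarrow> (nat \<Rightarrow> real)" where
  "vec_scale k c x = (\<lambda>i\<in>{1..k}. c * x i)"

definition l1_dist :: "nat \<Rightarrow> (nat \<Rightarrow> real) \<Rightarrow> (nat \<Rightarrow> real) \<Rightarrow> real" where
  "l1_dist k x y = (\<Sum>i=1..k. \<bar>x i - y i\<bar>)"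

definition K_cone :: "nat \<Rightarrow> (nat \<Rightarrow> real) set" where
  "K_cone k = {x \<in> Rvec k. 0 \<le> x 1 \<and> (\<forall>i\<in>{1..<k}. x i \<le> x (Suc i))}"


section \<open>Entropy distances\<close>

definition Ent_star :: "nat \<Rightarrow> diagram \<Rightarrow> (nat \<Rightarrow> real)" where
  "Ent_star k X = (\<lambda>i\<in>{1..k}. Ent (sp X i))"

definition two_fan ::
  "nat \<Rightarrow> diagram \<Rightarrow> diagram \<Rightarrow> diagram \<Rightarrow> (nat \<Rightarrow> nat \<Rightarrow> nat) \<Rightarrow> (nat \<Rightarrow> nat \<Rightarrow> nat) \<Rightarrow> bool" where
  "two_fan k X Z Y f g \<longleftrightarrow>
     Z \<in> Prob_chain k \<and> diagram_morphism k f Z X \<and> diagram_morphism k g Z Y"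

definition kd :: "nat \<Rightarrow> diagram \<Rightarrow> diagram \<Rightarrow> diagram \<Rightarrow> real" where
  "kd k X Z Y = l1_dist k (Ent_star k Z) (Ent_star k X) + l1_dist k (Ent_star k Z) (Ent_star k Y)"

definition intrinsic_dist :: "nat \<Rightarrow> diagram \<Rightarrow> diagram \<Rightarrow> real" where
  "intrinsic_dist k X Y = Inf {kd k X Z Y | Z f g. two_fan k X Z Y f g}"

definition kappa :: "nat \<Rightarrow> diagram \<Rightarrow> diagram \<Rightarrow> real" where
  "kappa k X Y =
     lim (\<lambda>n. (1 / real n) * intrinsic_dist k (tensor_power X n) (tensor_power Y n))"


section \<open>The tropical cone\<close>

definition phi :: "real \<Rightarrow> real" where
  "phi t = t powr (3 / 4)"

definition Prob_trop :: "nat \<Rightarrow> (nat \<Rightarrow> diagram) set" where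
  "Prob_trop k = {X. (\<forall>n. X n \<in> Prob_chain k) \<and> diagram_iso k (X 0) neutral \<and>
     (\<exists>C\<ge>0. \<forall>m\<ge>1. \<forall>n\<ge>1. kappa k (X (m + n)) (tensor (X m) (X n)) \<le> C * phi (real (m + n)))}"

definition trop_add :: "(nat \<Rightarrow> diagram) \<Rightarrow> (nat \<Rightarrow> diagram) \<Rightarrow> (nat \<Rightarrow> diagram)" where
  "trop_add X Y = (\<lambda>n. tensor (X n) (Y n))"

definition trop_scale :: "real \<Rightarrow> (nat \<Rightarrow> diagram) \<Rightarrow> (nat \<Rightarrow> diagram)" where
  "trop_scale c X = (\<lambda>n. X (nat \<lfloor>c * real n\<rfloor>))"

definition kappa_hat :: "nat \<Rightarrow> (nat \<Rightarrow> diagram) \<Rightarrow> (nat \<Rightarrow> diagram) \<Rightarrow> real" where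
  "kappa_hat k X Y = lim (\<lambda>n. (1 / real n) * kappa k (X n) (Y n))"

end

theory Submission
  imports Defs "HOL-Real_Asymp.Real_Asymp"
begin

text \<open>For chains, \<open>\<kappa>\<close> is the \<open>\<ell>\<^sup>1\<close>-distance of the entropy vectors. Only the upper bound needs an
  idea. Order the atoms of every level lexicographically, so that the arrows of both chains are
  monotone, and take the comonotone (quantile) coupling \<open>J\<close> of the two top spaces. Its images are
  comonotone couplings at all levels simultaneously. As the joint atoms of such a coupling satisfy
  \<open>\<Sum> min (p x) (q y) \<le> 2\<close>, Jensen's inequality gives
  \<open>Ent J \<le> E (max (- ln p) (- ln q)) + ln 2\<close>. For \<open>n\<close>-th tensor powers \<open>- ln p\<close> and \<open>- ln q\<close> deviate
  from their means, the entropies, by \<open>O(\<surd>n)\<close> in expectation, because their variances are additive.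
  Hence the fan \<open>J\<close> has \<open>kd\<close> at most \<open>n\<close> times the \<open>\<ell>\<^sup>1\<close>-distance plus \<open>O(\<surd>n)\<close>.

  An element of the tropical cone therefore amounts to a quasi-additive sequence of entropy vectors,
  and the isomorphism maps it to the limit of the \<open>n\<close>-th entropy vector divided by \<open>n\<close>.\<close>

section \<open>Entropy and its variance\<close>

lemma Ent_eq_expectation:
  assumes "finite_space p"
  shows "Ent p = measure_pmf.expectation p (\<lambda>x. - ln (pmf p x))"
  using assms unfolding Ent_def finite_space_def
  by (subst integral_measure_pmf_real[where A="set_pmf p"]) (auto simp: sum_negf mult.commute)

lemma finite_space_map: "finite_space p \<Longrightarrow> finite_space (map_pmf f p)"
  by (simp add: finite_space_def)

lemma finite_space_pair: "finite_space p \<Longrightarrow> finite_space q \<Longrightarrow> finite_space (pair_pmf p q)"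
  by (simp add: finite_space_def)

lemma integrable_finite_space:
  fixes f :: "'a \<Rightarrow> real"
  shows "finite_space p \<Longrightarrow> integrable (measure_pmf p) f"
  unfolding finite_space_def by (rule integrable_measure_pmf_finite)

lemma expectation_mono_on_support:
  fixes f g :: "'a \<Rightarrow> real"
  assumes "finite_space p" "\<And>x. x \<in> set_pmf p \<Longrightarrow> f x \<le> g x"
  shows "measure_pmf.expectation p f \<le> measure_pmf.expectation p g"
  using assms by (intro integral_mono_AE integrable_finite_space) (auto simp: AE_measure_pmf_iff)

lemma pmf_le_pmf_map: "pmf p x \<le> pmf (map_pmf f p) (f x)"
proof -
  have "pmf p x = measure p {x}" by (simp add: pmf.rep_eq)
  also have "\<dots> \<le> measure p (f -` {f x})"
    by (intro measure_pmf.finite_measure_mono) auto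
  finally show ?thesis by (simp add: pmf_map)
qed

lemma Ent_nonneg: "0 \<le> Ent p"
proof -
  have "(\<Sum>x\<in>set_pmf p. pmf p x * ln (pmf p x)) \<le> 0"
    by (intro sum_nonpos mult_nonneg_nonpos) (auto simp: pmf_le_1 pmf_positive)
  then show ?thesis by (simp add: Ent_def)
qed

text \<open>A point is at most as heavy as its image, so \<open>- ln\<close> of the mass drops
  pointwise; both entropies are expectations over \<open>p\<close>.\<close>

lemma Ent_map_le:
  assumes "finite_space p"
  shows "Ent (map_pmf f p) \<le> Ent p"
  using assms pmf_le_pmf_map[of p _ f]
  by (auto simp: Ent_eq_expectation finite_space_map pmf_positive intro!: expectation_mono_on_support)

lemma Ent_map_inj:
  assumes "inj_on f (set_pmf p)"
  shows "Ent (map_pmf f p) = Ent p"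
  unfolding Ent_def set_map_pmf
  by (subst sum.reindex) (use assms in \<open>auto simp: pmf_map_inj\<close>)

text \<open>The variance of the information content \<open>- ln (pmf p x)\<close>, whose mean is
  \<open>Ent p\<close>.\<close>

definition varent :: "'a pmf \<Rightarrow> real" where
  "varent p = (\<Sum>x\<in>set_pmf p. pmf p x * (- ln (pmf p x) - Ent p)\<^sup>2)"

lemma varent_map_inj:
  assumes "inj_on f (set_pmf p)"
  shows "varent (map_pmf f p) = varent p"
  unfolding varent_def set_map_pmf Ent_map_inj[OF assms]
  by (subst sum.reindex) (use assms in \<open>auto simp: pmf_map_inj\<close>)

lemma sum_pmf_set_pmf: "finite_space p \<Longrightarrow> (\<Sum>x\<in>set_pmf p. pmf p x) = 1"
  by (rule sum_pmf_eq_1) (auto simp: finite_space_def)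

text \<open>\<open>F\<close> is curried so that the rule matches a summand written as an explicit
  function of \<open>fst z\<close> and \<open>snd z\<close>.\<close>

lemma sum_pair_pmf:
  fixes F :: "'a \<Rightarrow> 'b \<Rightarrow> real"
  shows "(\<Sum>z\<in>set_pmf (pair_pmf p q). F (fst z) (snd z)) = (\<Sum>x\<in>set_pmf p. \<Sum>y\<in>set_pmf q. F x y)"
  by (simp add: sum.cartesian_product case_prod_beta)

lemma Ent_pair:
  assumes "finite_space p" "finite_space q"
  shows "Ent (pair_pmf p q) = Ent p + Ent q"
proof -
  have "(\<Sum>z\<in>set_pmf (pair_pmf p q). pmf (pair_pmf p q) z * ln (pmf (pair_pmf p q) z))
     = (\<Sum>z\<in>set_pmf (pair_pmf p q). (\<lambda>x y. pmf p x * pmf q y * (ln (pmf p x) + ln (pmf q y))) (fst z) (snd z))"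
    by (intro sum.cong) (auto simp: pmf_pair ln_mult pmf_positive)
  also have "\<dots> = (\<Sum>x\<in>set_pmf p. \<Sum>y\<in>set_pmf q. pmf p x * pmf q y * (ln (pmf p x) + ln (pmf q y)))"
    by (rule sum_pair_pmf)
  also have "\<dots> = (\<Sum>x\<in>set_pmf p. pmf p x * ln (pmf p x) * (\<Sum>y\<in>set_pmf q. pmf q y)
       + pmf p x * (\<Sum>y\<in>set_pmf q. pmf q y * ln (pmf q y)))"
    by (intro sum.cong refl) (simp add: sum_distrib_left sum.distrib algebra_simps)
  also have "\<dots> = - Ent p + (\<Sum>x\<in>set_pmf p. pmf p x) * (- Ent q)"
    by (simp only: sum.distrib sum_distrib_right Ent_def sum_pmf_set_pmf[OF assms(2)]) simp
  finally show ?thesis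
    using sum_pmf_set_pmf[OF assms(1)] by (simp add: Ent_def)
qed

lemma sum_centred_info:
  assumes "finite_space p"
  shows "(\<Sum>x\<in>set_pmf p. pmf p x * (- ln (pmf p x) - Ent p)) = 0"
proof -
  have "(\<Sum>x\<in>set_pmf p. pmf p x * (- ln (pmf p x) - Ent p))
     = Ent p - (\<Sum>x\<in>set_pmf p. pmf p x) * Ent p"
    unfolding sum_distrib_right by (simp add: Ent_def right_diff_distrib sum_subtractf sum_negf)
  with sum_pmf_set_pmf[OF assms] show ?thesis by simp
qed

text \<open>Information contents add under products, and the cross term of the square vanishes
  because the centred content of \<open>q\<close> has mean 0.\<close>

lemma varent_pair:
  assumes "finite_space p" "finite_space q"
  shows "varent (pair_pmf p q) = varent p + varent q"
proof -
  define u where "u x = - ln (pmf p x) - Ent p" for x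
  define v where "v y = - ln (pmf q y) - Ent q" for y
  have "varent (pair_pmf p q)
     = (\<Sum>z\<in>set_pmf (pair_pmf p q). (\<lambda>x y. pmf p x * pmf q y * (u x + v y)\<^sup>2) (fst z) (snd z))"
    unfolding varent_def Ent_pair[OF assms] u_def v_def
    by (intro sum.cong) (auto simp: pmf_pair ln_mult pmf_positive algebra_simps)
  also have "\<dots> = (\<Sum>x\<in>set_pmf p. \<Sum>y\<in>set_pmf q. pmf p x * pmf q y * (u x + v y)\<^sup>2)"
    by (rule sum_pair_pmf)
  also have "\<dots> = (\<Sum>x\<in>set_pmf p. pmf p x * (u x)\<^sup>2 * (\<Sum>y\<in>set_pmf q. pmf q y)
       + 2 * (pmf p x * u x) * (\<Sum>y\<in>set_pmf q. pmf q y * v y)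
       + pmf p x * (\<Sum>y\<in>set_pmf q. pmf q y * (v y)\<^sup>2))"
    by (intro sum.cong refl)
       (simp add: sum_distrib_left sum_distrib_right sum.distrib algebra_simps power2_sum)
  also have "\<dots> = varent p + (\<Sum>x\<in>set_pmf p. pmf p x) * varent q"
    using sum_centred_info[OF assms(2)]
    by (simp add: sum.distrib sum_distrib_right varent_def sum_pmf_set_pmf[OF assms(2)] u_def v_def)
  finally show ?thesis
    using sum_pmf_set_pmf[OF assms(1)] by simp
qed

text \<open>The variance of the absolute deviation is nonnegative, so its squared mean is at most
  its mean square.\<close>

lemma expectation_abs_deviation_le:
  assumes "finite_space p"
  shows "measure_pmf.expectation p (\<lambda>x. \<bar>- ln (pmf p x) - Ent p\<bar>) \<le> sqrt (varent p)"
proof -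
  have "(measure_pmf.expectation p (\<lambda>x. \<bar>- ln (pmf p x) - Ent p\<bar>))\<^sup>2
     \<le> measure_pmf.expectation p (\<lambda>x. \<bar>- ln (pmf p x) - Ent p\<bar>\<^sup>2)"
    using measure_pmf.variance_positive[of p "\<lambda>x. \<bar>- ln (pmf p x) - Ent p\<bar>"]
    by (subst (asm) measure_pmf.variance_eq) (auto intro: integrable_finite_space[OF assms])
  also have "\<dots> = varent p"
    unfolding varent_def using assms
    by (subst integral_measure_pmf_real[where A="set_pmf p"])
       (auto simp: finite_space_def mult.commute)
  finally show ?thesis by (rule real_le_rsqrt)
qed

section \<open>Comonotone couplings\<close>

text \<open>The set is a chain in the product of two preorders. These are given by ranks because
  each level of a diagram will carry an order of its own.\<close>

definition comonotone :: "('a \<Rightarrow> nat) \<Rightarrow> ('b \<Rightarrow> nat) \<Rightarrow> ('a \<times> 'b) set \<Rightarrow> bool" where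
  "comonotone r s S \<longleftrightarrow> (\<forall>(a, b)\<in>S. \<forall>(a', b')\<in>S.
     (r a \<le> r a' \<and> s b \<le> s b') \<or> (r a' \<le> r a \<and> s b' \<le> s b))"

text \<open>Couplings of mass functions rather than of distributions: the induction below strips off
  mass, so the total need not stay 1.\<close>

definition transport_plan ::
  "'a set \<Rightarrow> ('a \<Rightarrow> real) \<Rightarrow> 'b set \<Rightarrow> ('b \<Rightarrow> real) \<Rightarrow> ('a \<times> 'b \<Rightarrow> real) \<Rightarrow> bool" where
  "transport_plan A f B g w \<longleftrightarrow> (\<forall>z. 0 \<le> w z) \<and> {z. w z \<noteq> 0} \<subseteq> A \<times> B \<and>
    (\<forall>a\<in>A. (\<Sum>b\<in>B. w (a, b)) = f a) \<and> (\<forall>b\<in>B. (\<Sum>a\<in>A. w (a, b)) = g b)"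

lemma comonotone_insert_max:
  assumes "comonotone r s S" "S \<subseteq> A \<times> B" "\<And>a'. a' \<in> A \<Longrightarrow> r a' \<le> r a" "\<And>b'. b' \<in> B \<Longrightarrow> s b' \<le> s b"
  shows "comonotone r s (insert (a, b) S)"
proof -
  have "r x \<le> r a \<and> s y \<le> s b" if "(x, y) \<in> S" for x y
    using that assms by blast
  with assms(1) show ?thesis unfolding comonotone_def by auto
qed

lemma comonotone_mono: "comonotone r s S \<Longrightarrow> T \<subseteq> S \<Longrightarrow> comonotone r s T"
  unfolding comonotone_def by blast

lemma finite_has_max_rank:
  fixes r :: "'a \<Rightarrow> nat"
  assumes "finite A" "A \<noteq> {}"
  obtains a where "a \<in> A" "\<And>a'. a' \<in> A \<Longrightarrow> r a' \<le> r a"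
proof -
  have "Max (r ` A) \<in> r ` A" using assms by (intro Max_in) auto
  then obtain a where "a \<in> A" "Max (r ` A) = r a" by auto
  with assms that show ?thesis by (metis Max_ge finite_imageI imageI)
qed

text \<open>The inductive step of the corner rule: row \<open>a\<close> goes entirely to column
  \<open>b\<close>, whose demand was lowered by \<open>f a\<close> beforehand.\<close>

lemma transport_plan_add_row:
  assumes w: "transport_plan (A - {a}) f B (g(b := g b - f a)) w"
    and "finite A" "finite B" "a \<in> A" "b \<in> B" "0 \<le> f a"
  shows "transport_plan A f B g (\<lambda>z. if fst z = a then if snd z = b then f a else 0 else w z)"
proof -
  define w' where "w' = (\<lambda>z. if fst z = a then if snd z = b then f a else 0 else w z)"
  have row: "(\<Sum>y\<in>B. w' (x, y)) = f x" if "x \<in> A" for x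
    using w that assms by (cases "x = a") (auto simp: w'_def transport_plan_def)
  have col: "(\<Sum>x\<in>A. w' (x, y)) = g y" if "y \<in> B" for y
  proof -
    have "(\<Sum>x\<in>A. w' (x, y)) = w' (a, y) + (\<Sum>x\<in>A - {a}. w' (x, y))"
      using assms by (simp add: sum.remove)
    also have "(\<Sum>x\<in>A - {a}. w' (x, y)) = (\<Sum>x\<in>A - {a}. w (x, y))"
      by (intro sum.cong) (auto simp: w'_def)
    also have "\<dots> = (g(b := g b - f a)) y"
      using w that unfolding transport_plan_def by blast
    finally show ?thesis by (auto simp: w'_def)
  qed
  have "0 \<le> w' z" for z
    using w assms by (cases z) (simp add: transport_plan_def w'_def)
  moreover have "{z. w' z \<noteq> 0} \<subseteq> A \<times> B"
    using w assms by (auto simp: transport_plan_def w'_def split: if_splits)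
  ultimately show ?thesis
    unfolding transport_plan_def w'_def[symmetric] using row col by blast
qed

text \<open>Lets an exhausted column be treated as an exhausted row.\<close>

lemma transport_plan_swap:
  "transport_plan A f B g w \<Longrightarrow> transport_plan B g A f (\<lambda>z. w (prod.swap z))"
  by (auto simp: transport_plan_def)

text \<open>The north-west corner rule: the heaviest possible mass is sent between the two largest
  points, which exhausts one of them.\<close>

lemma comonotone_transport_plan_exists:
  fixes f :: "'a \<Rightarrow> real" and g :: "'b \<Rightarrow> real"
  assumes "finite A" "finite B" "\<And>a. a \<in> A \<Longrightarrow> 0 \<le> f a" "\<And>b. b \<in> B \<Longrightarrow> 0 \<le> g b"
    and "sum f A = sum g B"
  shows "\<exists>w. transport_plan A f B g w \<and> comonotone r s {z. w z \<noteq> 0}"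
  using assms
proof (induction "card A + card B" arbitrary: A B f g rule: less_induct)
  case less
  show ?case
  proof (cases "A = {} \<or> B = {}")
    case True
    \<comment> \<open>An empty side makes both total masses 0, and nonnegative masses of total 0
      vanish.\<close>
    then have "\<forall>a\<in>A. f a = 0" "\<forall>b\<in>B. g b = 0"
      using less.prems by (auto simp: sum_nonneg_eq_0_iff dest!: sym[of 0])
    then have "transport_plan A f B g (\<lambda>_. 0)" by (auto simp: transport_plan_def)
    moreover have "comonotone r s {z. (0 :: real) \<noteq> 0}" by (simp add: comonotone_def)
    ultimately show ?thesis by blast
  next
    case False
    obtain a where a: "a \<in> A" "\<And>a'. a' \<in> A \<Longrightarrow> r a' \<le> r a"
      using finite_has_max_rank[of A r] False less.prems(1) by metis
    obtain b where b: "b \<in> B" "\<And>b'. b' \<in> B \<Longrightarrow> s b' \<le> s b"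
      using finite_has_max_rank[of B s] False less.prems(2) by metis
    show ?thesis
    proof (cases "f a \<le> g b")
      case True
      let ?g = "g(b := g b - f a)"
      have "card (A - {a}) < card A" using a(1) less.prems(1) by (meson card_Diff1_less)
      moreover have "sum f (A - {a}) = sum ?g B"
        using a(1) b(1) less.prems by (simp add: sum.remove[of B b] sum.remove[of A a])
      ultimately have "\<exists>w. transport_plan (A - {a}) f B ?g w \<and> comonotone r s {z. w z \<noteq> 0}"
        using True less.prems by (intro less.hyps) auto
      then obtain w where w: "transport_plan (A - {a}) f B ?g w" "comonotone r s {z. w z \<noteq> 0}"
        by blast
      define w' where "w' = (\<lambda>z. if fst z = a then if snd z = b then f a else 0 else w z)"
      have "transport_plan A f B g w'"
        unfolding w'_def using w a(1) b(1) less.prems by (intro transport_plan_add_row) auto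
      moreover have "comonotone r s (insert (a, b) {z. w z \<noteq> 0})"
        using a b w by (intro comonotone_insert_max[of r s _ A B]) (auto simp: transport_plan_def)
      then have "comonotone r s {z. w' z \<noteq> 0}"
        by (rule comonotone_mono) (auto simp: w'_def split: if_splits)
      ultimately show ?thesis by blast
    next
      case False
      let ?f = "f(a := f a - g b)"
      have "card (B - {b}) < card B" using b(1) less.prems(2) by (meson card_Diff1_less)
      moreover have "sum ?f A = sum g (B - {b})"
        using a(1) b(1) less.prems by (simp add: sum.remove[of B b] sum.remove[of A a])
      ultimately have "\<exists>w. transport_plan A ?f (B - {b}) g w \<and> comonotone r s {z. w z \<noteq> 0}"
        using False less.prems by (intro less.hyps) auto
      then obtain w where w: "transport_plan A ?f (B - {b}) g w" "comonotone r s {z. w z \<noteq> 0}"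
        by blast
      define w' where "w' = (\<lambda>z. if fst z = b then if snd z = a then g b else 0 else w (prod.swap z))"
      have "transport_plan B g A f w'"
        unfolding w'_def using transport_plan_swap[OF w(1)] a(1) b(1) less.prems
        by (intro transport_plan_add_row) auto
      then have "transport_plan A f B g (\<lambda>z. w' (prod.swap z))" by (rule transport_plan_swap)
      moreover have "comonotone r s (insert (a, b) {z. w z \<noteq> 0})"
        using a b w by (intro comonotone_insert_max[of r s _ A B]) (auto simp: transport_plan_def)
      then have "comonotone r s {z. w' (prod.swap z) \<noteq> 0}"
        by (rule comonotone_mono) (auto simp: w'_def split: if_splits)
      ultimately show ?thesis by blast
    qed
  qed
qed

text \<open>A transport plan between two probability mass functions has total mass 1, hence is
  itself the mass function of a coupling.\<close>

lemma comonotone_coupling_exists: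
  assumes "finite_space p" "finite_space q"
  shows "\<exists>J. map_pmf fst J = p \<and> map_pmf snd J = q \<and> comonotone r s (set_pmf J)"
proof -
  let ?A = "set_pmf p" and ?B = "set_pmf q"
  have fin: "finite ?A" "finite ?B" using assms by (auto simp: finite_space_def)
  have "\<exists>w. transport_plan ?A (pmf p) ?B (pmf q) w \<and> comonotone r s {z. w z \<noteq> 0}"
    using fin assms by (intro comonotone_transport_plan_exists) (auto simp: sum_pmf_set_pmf)
  then obtain w where plan: "transport_plan ?A (pmf p) ?B (pmf q) w"
    and com: "comonotone r s {z. w z \<noteq> 0}" by blast
  have w: "\<And>z. 0 \<le> w z" "{z. w z \<noteq> 0} \<subseteq> ?A \<times> ?B"
    "\<And>a. a \<in> ?A \<Longrightarrow> (\<Sum>b\<in>?B. w (a, b)) = pmf p a"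
    "\<And>b. b \<in> ?B \<Longrightarrow> (\<Sum>a\<in>?A. w (a, b)) = pmf q b"
    using plan by (auto simp: transport_plan_def)
  have w0: "w z = 0" if "z \<notin> ?A \<times> ?B" for z
    using w(2) that by blast
  have "(\<integral>\<^sup>+ z. ennreal (w z) \<partial>count_space UNIV) = (\<Sum>z\<in>?A \<times> ?B. ennreal (w z))"
    by (intro nn_integral_count_space') (use fin w0 in auto)
  also have "\<dots> = ennreal (\<Sum>a\<in>?A. \<Sum>b\<in>?B. w (a, b))"
    using w(1) by (subst sum_ennreal) (auto simp: sum.cartesian_product)
  also have "(\<Sum>a\<in>?A. \<Sum>b\<in>?B. w (a, b)) = 1"
    using w(3) sum_pmf_set_pmf[OF assms(1)] by simp
  finally have one: "(\<integral>\<^sup>+ z. ennreal (w z) \<partial>count_space UNIV) = 1" by simp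
  define J where "J = embed_pmf w"
  have pJ: "pmf J z = w z" for z
    unfolding J_def by (rule pmf_embed_pmf) (use w(1) one in auto)
  have supp: "set_pmf J = {z. w z \<noteq> 0}" by (auto simp: set_pmf_iff pJ)
  have sub: "set_pmf J \<subseteq> ?A \<times> ?B" using w(2) by (simp add: supp)
  have "pmf (map_pmf fst J) a = pmf p a" for a
  proof -
    \<comment> \<open>Intersecting with the support trades the fibre of \<open>fst\<close>, possibly
      infinite, for the finite set \<open>{a} \<times> ?B\<close>.\<close>
    have "pmf (map_pmf fst J) a = measure J (fst -` {a} \<inter> set_pmf J)"
      by (simp add: pmf_map measure_Int_set_pmf)
    also have "\<dots> = measure J (({a} \<times> ?B) \<inter> set_pmf J)"
      using sub by (intro arg_cong[where f="measure J"]) auto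
    also have "\<dots> = measure J ({a} \<times> ?B)" by (simp add: measure_Int_set_pmf)
    also have "\<dots> = (\<Sum>z\<in>{a} \<times> ?B. w z)"
      using fin by (subst measure_measure_pmf_finite) (auto simp: pJ)
    also have "\<dots> = (\<Sum>b\<in>?B. w (a, b))"
      using sum.cartesian_product[of "\<lambda>x y. w (x, y)" ?B "{a}"] by simp
    also have "\<dots> = pmf p a"
    proof (cases "a \<in> ?A")
      case False
      then have "\<forall>b. w (a, b) = 0" using w(2) by blast
      with False show ?thesis by (simp add: set_pmf_iff)
    qed (rule w(3))
    finally show ?thesis .
  qed
  moreover have "pmf (map_pmf snd J) b = pmf q b" for b
  proof -
    have "pmf (map_pmf snd J) b = measure J (snd -` {b} \<inter> set_pmf J)"
      by (simp add: pmf_map measure_Int_set_pmf)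
    also have "\<dots> = measure J ((?A \<times> {b}) \<inter> set_pmf J)"
      using sub by (intro arg_cong[where f="measure J"]) auto
    also have "\<dots> = measure J (?A \<times> {b})" by (simp add: measure_Int_set_pmf)
    also have "\<dots> = (\<Sum>z\<in>?A \<times> {b}. w z)"
      using fin by (subst measure_measure_pmf_finite) (auto simp: pJ)
    also have "\<dots> = (\<Sum>a\<in>?A. w (a, b))"
      using sum.cartesian_product[of "\<lambda>x y. w (x, y)" "{b}" ?A] by simp
    also have "\<dots> = pmf q b"
    proof (cases "b \<in> ?B")
      case False
      then have "\<forall>a. w (a, b) = 0" using w(2) by blast
      with False show ?thesis by (simp add: set_pmf_iff)
    qed (rule w(4))
    finally show ?thesis .
  qed
  ultimately show ?thesis
    using com supp by (intro exI[of _ J]) (auto intro!: pmf_eqI)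
qed

section \<open>Entropy of a comonotone coupling\<close>

lemma sum_pmf_le_1: "finite A \<Longrightarrow> (\<Sum>x\<in>A. pmf p x) \<le> 1"
  using measure_pmf.prob_le_1[of p A] by (simp add: measure_measure_pmf_finite)

text \<open>Every point of a comonotone set is the first one in its row or the first one in its column.\<close>

lemma sum_min_comonotone_le:
  assumes fin: "finite_space J" and com: "comonotone r s (set_pmf J)"
    and r: "inj_on r (fst ` set_pmf J)" and s: "inj_on s (snd ` set_pmf J)"
  shows "(\<Sum>z\<in>set_pmf J. min (pmf p (fst z)) (pmf q (snd z))) \<le> 2"
proof -
  let ?S = "set_pmf J" and ?m = "\<lambda>z. min (pmf p (fst z)) (pmf q (snd z))"
  define R where "R = {z \<in> ?S. \<forall>z'\<in>?S. fst z' = fst z \<longrightarrow> s (snd z) \<le> s (snd z')}"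
  define C where "C = {z \<in> ?S. \<forall>z'\<in>?S. snd z' = snd z \<longrightarrow> r (fst z) \<le> r (fst z')}"
  have S: "finite ?S" using fin by (simp add: finite_space_def)
  then have finRC: "finite R" "finite C" by (auto simp: R_def C_def)
  \<comment> \<open>Otherwise a point of smaller second rank in the same row and one of smaller
    first rank in the same column would be incomparable.\<close>
  have "z \<in> R \<union> C" if z: "z \<in> ?S" for z
  proof (rule ccontr)
    assume "z \<notin> R \<union> C"
    with z obtain z1 z2 where *: "z1 \<in> ?S" "fst z1 = fst z" "s (snd z1) < s (snd z)"
      "z2 \<in> ?S" "snd z2 = snd z" "r (fst z2) < r (fst z)"
      by (auto simp: R_def C_def not_le)
    from com \<open>z1 \<in> ?S\<close> \<open>z2 \<in> ?S\<close>
    have "(r (fst z1) \<le> r (fst z2) \<and> s (snd z1) \<le> s (snd z2)) \<or>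
          (r (fst z2) \<le> r (fst z1) \<and> s (snd z2) \<le> s (snd z1))"
      by (auto simp: comonotone_def case_prod_beta)
    with * show False by simp
  qed
  then have "sum ?m ?S \<le> sum ?m (R \<union> C)"
    by (intro sum_mono2) (use finRC in auto)
  also have "\<dots> \<le> sum ?m R + sum ?m C"
  proof -
    have "0 \<le> sum ?m (R \<inter> C)" by (intro sum_nonneg) simp
    with sum.union_inter[OF finRC, of ?m] show ?thesis by linarith
  qed
  \<comment> \<open>In \<open>R\<close> every first coordinate occurs once, so the minimum is
    bounded by \<open>pmf p\<close>, with total at most 1; \<open>C\<close> is treated symmetrically
    with \<open>pmf q\<close>.\<close>
  also have "sum ?m R \<le> (\<Sum>z\<in>R. pmf p (fst z))" by (intro sum_mono) simp
  also have "\<dots> = (\<Sum>a\<in>fst ` R. pmf p a)"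
  proof (subst sum.reindex)
    show "inj_on fst R"
    proof (rule inj_onI)
      fix z z' assume z: "z \<in> R" "z' \<in> R" "fst z = fst z'"
      then have "s (snd z) = s (snd z')" by (auto simp: R_def intro: antisym)
      with s z have "snd z = snd z'" by (auto simp: R_def dest: inj_onD)
      with z show "z = z'" by (simp add: prod_eq_iff)
    qed
  qed simp
  also have "\<dots> \<le> 1" by (rule sum_pmf_le_1) (use finRC in simp)
  also have "sum ?m C \<le> (\<Sum>z\<in>C. pmf q (snd z))" by (intro sum_mono) simp
  also have "\<dots> = (\<Sum>b\<in>snd ` C. pmf q b)"
  proof (subst sum.reindex)
    show "inj_on snd C"
    proof (rule inj_onI)
      fix z z' assume z: "z \<in> C" "z' \<in> C" "snd z = snd z'"
      then have "r (fst z) = r (fst z')" by (auto simp: C_def intro: antisym)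
      with r z have "fst z = fst z'" by (auto simp: C_def dest: inj_onD)
      with z show "z = z'" by (simp add: prod_eq_iff)
    qed
  qed simp
  also have "\<dots> \<le> 1" by (rule sum_pmf_le_1) (use finRC in simp)
  finally show ?thesis by simp
qed

text \<open>Gibbs' inequality against the weights \<open>?m z / 2\<close>, whose total is at most 1
  by \<open>sum_min_comonotone_le\<close>; the halving costs \<open>ln 2\<close>.\<close>

lemma Ent_comonotone_le_expectation:
  assumes fin: "finite_space J" and com: "comonotone r s (set_pmf J)"
    and p: "map_pmf fst J = p" and q: "map_pmf snd J = q"
    and r: "inj_on r (set_pmf p)" and s: "inj_on s (set_pmf q)"
  shows "Ent J \<le> measure_pmf.expectation J
           (\<lambda>z. max (- ln (pmf p (fst z))) (- ln (pmf q (snd z)))) + ln 2"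
proof -
  let ?S = "set_pmf J" and ?m = "\<lambda>z. min (pmf p (fst z)) (pmf q (snd z))"
  let ?M = "\<lambda>z. max (- ln (pmf p (fst z))) (- ln (pmf q (snd z)))"
  have supp: "set_pmf p = fst ` ?S" "set_pmf q = snd ` ?S" unfolding p[symmetric] q[symmetric] by simp_all
  have "Ent J = (\<Sum>z\<in>?S. pmf J z * (- ln (pmf J z)))"
    by (simp add: Ent_def sum_negf)
  also have "\<dots> \<le> (\<Sum>z\<in>?S. pmf J z * ?M z + ln 2 * pmf J z + (?m z / 2 - pmf J z))"
  proof (rule sum_mono)
    fix z assume z: "z \<in> ?S"
    then have pos: "0 < pmf p (fst z)" "0 < pmf q (snd z)" "0 < pmf J z"
      using supp by (auto simp: pmf_positive_iff)
    define c where "c = ?m z"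
    have M: "?M z = - ln c" using pos by (auto simp: c_def min_def max_def)
    have c: "0 < c" using pos by (simp add: c_def)
    \<comment> \<open>The tangent bound \<open>ln t \<le> t - 1\<close> at the ratio of the
      reference weight \<open>c / 2\<close> to the weight of \<open>z\<close>; after weighting, the
      right-hand sides sum to at most 0.\<close>
    have "ln (c / (2 * pmf J z)) \<le> c / (2 * pmf J z) - 1"
      using c pos by (intro ln_le_minus_one) auto
    moreover have "ln (c / (2 * pmf J z)) = ln c - ln 2 - ln (pmf J z)"
      using c pos by (simp add: ln_div ln_mult)
    ultimately have "- ln (pmf J z) \<le> ?M z + ln 2 + (c / (2 * pmf J z) - 1)"
      unfolding M by linarith
    then have "pmf J z * (- ln (pmf J z)) \<le> pmf J z * (?M z + ln 2 + (c / (2 * pmf J z) - 1))"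
      using pos by (intro mult_left_mono) auto
    also have "\<dots> = pmf J z * ?M z + ln 2 * pmf J z + (?m z / 2 - pmf J z)"
      unfolding c_def[symmetric] using pos by (simp add: field_simps)
    finally show "pmf J z * (- ln (pmf J z)) \<le> \<dots>" .
  qed
  also have "\<dots> = (\<Sum>z\<in>?S. pmf J z * ?M z) + ln 2 * (\<Sum>z\<in>?S. pmf J z)
      + (sum ?m ?S / 2 - (\<Sum>z\<in>?S. pmf J z))"
    by (simp add: sum.distrib sum_subtractf sum_distrib_left sum_divide_distrib)
  also have "\<dots> \<le> (\<Sum>z\<in>?S. pmf J z * ?M z) + ln 2"
    using sum_min_comonotone_le[OF fin com, of p q] r s supp
    by (simp add: sum_pmf_set_pmf[OF fin])
  also have "(\<Sum>z\<in>?S. pmf J z * ?M z) = measure_pmf.expectation J ?M"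
    using fin by (subst integral_measure_pmf_real[where A="?S"]) (auto simp: finite_space_def mult.commute)
  finally show ?thesis .
qed

text \<open>Pointwise the larger information content exceeds the larger entropy by at most the sum
  of both absolute deviations, and the expectations of these depend only on the marginals.\<close>

lemma Ent_comonotone_le:
  assumes fin: "finite_space J" and com: "comonotone r s (set_pmf J)"
    and p: "map_pmf fst J = p" and q: "map_pmf snd J = q"
    and r: "inj_on r (set_pmf p)" and s: "inj_on s (set_pmf q)"
  shows "Ent J \<le> max (Ent p) (Ent q) + sqrt (varent p) + sqrt (varent q) + ln 2"
proof -
  let ?u = "\<lambda>x. \<bar>- ln (pmf p x) - Ent p\<bar>" and ?v = "\<lambda>y. \<bar>- ln (pmf q y) - Ent q\<bar>"
  have fpq: "finite_space p" "finite_space q" using fin p q by (auto simp: finite_space_def)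
  note [simp] = integrable_finite_space[OF fin]
  have "measure_pmf.expectation J (\<lambda>z. max (- ln (pmf p (fst z))) (- ln (pmf q (snd z))))
      \<le> measure_pmf.expectation J (\<lambda>z. max (Ent p) (Ent q) + ?u (fst z) + ?v (snd z))"
    by (rule expectation_mono_on_support[OF fin]) linarith
  also have "\<dots> = max (Ent p) (Ent q) + measure_pmf.expectation J (\<lambda>z. ?u (fst z))
      + measure_pmf.expectation J (\<lambda>z. ?v (snd z))"
    by (subst Bochner_Integration.integral_add, simp, simp)+ simp
  also have "measure_pmf.expectation J (\<lambda>z. ?u (fst z)) = measure_pmf.expectation p ?u"
    by (simp add: p[symmetric])
  also have "measure_pmf.expectation J (\<lambda>z. ?v (snd z)) = measure_pmf.expectation q ?v"
    by (simp add: q[symmetric])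
  also note expectation_abs_deviation_le[OF fpq(1)]
  also note expectation_abs_deviation_le[OF fpq(2)]
  finally show ?thesis
    using Ent_comonotone_le_expectation[OF assms] by linarith
qed

text \<open>Monotonicity is required only on the projections of \<open>S\<close>, since the arrows
  of a chain are controlled only on supports.\<close>

lemma comonotone_image:
  assumes com: "comonotone r s S"
    and r: "\<And>a a'. a \<in> fst ` S \<Longrightarrow> a' \<in> fst ` S \<Longrightarrow> r a \<le> r a' \<Longrightarrow> r' (f a) \<le> r' (f a')"
    and s: "\<And>b b'. b \<in> snd ` S \<Longrightarrow> b' \<in> snd ` S \<Longrightarrow> s b \<le> s b' \<Longrightarrow> s' (g b) \<le> s' (g b')"
  shows "comonotone r' s' (map_prod f g ` S)"
proof -
  have "(r' (f a) \<le> r' (f a') \<and> s' (g b) \<le> s' (g b')) \<or> (r' (f a') \<le> r' (f a) \<and> s' (g b') \<le> s' (g b))"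
    if z: "(a, b) \<in> S" "(a', b') \<in> S" for a b a' b'
  proof -
    have "a \<in> fst ` S" "a' \<in> fst ` S" "b \<in> snd ` S" "b' \<in> snd ` S"
      using z by force+
    moreover have "(r a \<le> r a' \<and> s b \<le> s b') \<or> (r a' \<le> r a \<and> s b' \<le> s b)"
      using com z unfolding comonotone_def by fast
    ultimately show ?thesis using r s by blast
  qed
  then show ?thesis unfolding comonotone_def by (simp add: split_beta)
qed

section \<open>Fans between chains\<close>

text \<open>Ranking atoms by the base-\<open>M\<close> expansion of their images in all lower levels orders them
  lexicographically, so that the arrows become monotone.\<close>

primrec chain_rank :: "nat \<Rightarrow> diagram \<Rightarrow> nat \<Rightarrow> nat \<Rightarrow> nat" where
  "chain_rank M X 0 x = 0"
| "chain_rank M X (Suc i) x = chain_rank M X i (arr X i x) * M + x"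

text \<open>The last base-\<open>M\<close> digit of the rank is the point itself. Level 0, where the
  rank is constant, is excluded.\<close>

lemma inj_on_chain_rank:
  assumes "1 \<le> i" "A \<subseteq> {..<M}"
  shows "inj_on (chain_rank M X i) A"
proof (rule inj_onI)
  fix x y assume xy: "x \<in> A" "y \<in> A" "chain_rank M X i x = chain_rank M X i y"
  have "chain_rank M X i z mod M = z" if "z \<in> A" for z
    using that assms by (cases i) auto
  with xy show "x = y" by metis
qed

text \<open>The arrow deletes the last digit, and a strict drop in the leading digits outweighs any
  last digit below \<open>M\<close>.\<close>

lemma chain_rank_arr_mono:
  assumes "x < M" "y < M" "chain_rank M X (Suc i) x \<le> chain_rank M X (Suc i) y"
  shows "chain_rank M X i (arr X i x) \<le> chain_rank M X i (arr X i y)"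
proof (rule ccontr)
  let ?a = "chain_rank M X i (arr X i x)" and ?b = "chain_rank M X i (arr X i y)"
  assume "\<not> ?a \<le> ?b"
  then have "(?b + 1) * M \<le> ?a * M" by (intro mult_right_mono) auto
  with assms show False by simp
qed

lemma Prob_chain_bounded:
  assumes "X \<in> Prob_chain k"
  obtains M where "\<And>i. i \<in> {1..k} \<Longrightarrow> set_pmf (sp X i) \<subseteq> {..<M}"
proof -
  have "finite (\<Union>i\<in>{1..k}. set_pmf (sp X i))"
    using assms by (auto simp: Prob_chain_def finite_space_def)
  then obtain M where "\<forall>x\<in>(\<Union>i\<in>{1..k}. set_pmf (sp X i)). x < M"
    using finite_nat_set_iff_bounded by blast
  then show ?thesis by (intro that[of M]) auto
qed

text \<open>The recursion counts the steps \<open>d\<close> below the top, where the coupling is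
  chosen; the result lives at level \<open>k - d\<close>.\<close>

primrec push_down :: "nat \<Rightarrow> diagram \<Rightarrow> diagram \<Rightarrow> (nat \<times> nat) pmf \<Rightarrow> nat \<Rightarrow> (nat \<times> nat) pmf" where
  "push_down k X Y J 0 = J"
| "push_down k X Y J (Suc d) =
     map_pmf (map_prod (arr X (k - Suc d)) (arr Y (k - Suc d))) (push_down k X Y J d)"

text \<open>The marginals are inherited because arrows are reductions, and comonotonicity because
  arrows are monotone in the ranks of points below the bases \<open>M\<close> and
  \<open>N\<close>.\<close>

lemma push_down_coupling:
  assumes XY: "X \<in> Prob_chain k" "Y \<in> Prob_chain k"
    and M: "\<And>i. i \<in> {1..k} \<Longrightarrow> set_pmf (sp X i) \<subseteq> {..<M}"
    and N: "\<And>i. i \<in> {1..k} \<Longrightarrow> set_pmf (sp Y i) \<subseteq> {..<N}"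
    and J: "map_pmf fst J = sp X k" "map_pmf snd J = sp Y k"
      "comonotone (chain_rank M X k) (chain_rank N Y k) (set_pmf J)"
    and "d < k"
  shows "map_pmf fst (push_down k X Y J d) = sp X (k - d)
    \<and> map_pmf snd (push_down k X Y J d) = sp Y (k - d)
    \<and> comonotone (chain_rank M X (k - d)) (chain_rank N Y (k - d)) (set_pmf (push_down k X Y J d))"
  using \<open>d < k\<close>
proof (induction d)
  case 0
  with J show ?case by simp
next
  case (Suc d)
  define i where "i = k - Suc d"
  have i: "k - d = Suc i" "i \<in> {1..<k}" "Suc i \<in> {1..k}" using Suc.prems by (auto simp: i_def)
  let ?L = "push_down k X Y J d"
  have IH: "map_pmf fst ?L = sp X (Suc i)" "map_pmf snd ?L = sp Y (Suc i)"
    "comonotone (chain_rank M X (Suc i)) (chain_rank N Y (Suc i)) (set_pmf ?L)"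
    using Suc.IH[unfolded i(1)] Suc.prems by (simp_all del: chain_rank.simps)
  have bnd: "fst z < M" "snd z < N" if "z \<in> set_pmf ?L" for z
  proof -
    have "fst z \<in> set_pmf (sp X (Suc i))" "snd z \<in> set_pmf (sp Y (Suc i))"
      using that unfolding IH(1,2)[symmetric] by auto
    then show "fst z < M" "snd z < N" using M[OF i(3)] N[OF i(3)] by auto
  qed
  have "map_pmf fst (push_down k X Y J (Suc d)) = map_pmf (arr X i) (map_pmf fst ?L)"
    by (simp add: pmf.map_comp i_def o_def)
  then have 1: "map_pmf fst (push_down k X Y J (Suc d)) = sp X i"
    using XY i IH by (simp add: Prob_chain_def reduction_def)
  have "map_pmf snd (push_down k X Y J (Suc d)) = map_pmf (arr Y i) (map_pmf snd ?L)"
    by (simp add: pmf.map_comp i_def o_def)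
  then have 2: "map_pmf snd (push_down k X Y J (Suc d)) = sp Y i"
    using XY i IH by (simp add: Prob_chain_def reduction_def)
  have "comonotone (chain_rank M X i) (chain_rank N Y i) (map_prod (arr X i) (arr Y i) ` set_pmf ?L)"
    using bnd by (intro comonotone_image[OF IH(3)] chain_rank_arr_mono) auto
  then have 3: "comonotone (chain_rank M X i) (chain_rank N Y i) (set_pmf (push_down k X Y J (Suc d)))"
    by (simp add: i_def)
  show ?case using 1 2 3 by (simp add: i_def)
qed

text \<open>The apex consists of the images of one comonotone coupling of the top spaces. Its arrows
  act coordinatewise, so both projections commute with them.\<close>

lemma two_fan_exists:
  assumes XY: "X \<in> Prob_chain k" "Y \<in> Prob_chain k" and "1 \<le> k"
  obtains Z f g where "two_fan k X Z Y f g"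
    "\<And>i. i \<in> {1..k} \<Longrightarrow> Ent (sp Z i) \<le> max (Ent (sp X i)) (Ent (sp Y i))
       + sqrt (varent (sp X i)) + sqrt (varent (sp Y i)) + ln 2"
proof -
  obtain M where M: "\<And>i. i \<in> {1..k} \<Longrightarrow> set_pmf (sp X i) \<subseteq> {..<M}"
    using Prob_chain_bounded[OF XY(1)] by blast
  obtain N where N: "\<And>i. i \<in> {1..k} \<Longrightarrow> set_pmf (sp Y i) \<subseteq> {..<N}"
    using Prob_chain_bounded[OF XY(2)] by blast
  have "finite_space (sp X k)" "finite_space (sp Y k)"
    using XY \<open>1 \<le> k\<close> by (auto simp: Prob_chain_def)
  then obtain J where J: "map_pmf fst J = sp X k" "map_pmf snd J = sp Y k"
      "comonotone (chain_rank M X k) (chain_rank N Y k) (set_pmf J)"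
    using comonotone_coupling_exists by blast
  define L where "L i = push_down k X Y J (k - i)" for i
  have L: "map_pmf fst (L i) = sp X i" "map_pmf snd (L i) = sp Y i"
    "comonotone (chain_rank M X i) (chain_rank N Y i) (set_pmf (L i))" if "i \<in> {1..k}" for i
    using push_down_coupling[OF XY M N J, of "k - i"] that by (auto simp: L_def)
  have step: "map_pmf (map_prod (arr X i) (arr Y i)) (L (Suc i)) = L i" if "i \<in> {1..<k}" for i
  proof -
    \<comment> \<open>Level \<open>i\<close> is reached one step after level
      \<open>Suc i\<close>.\<close>
    have "k - i = Suc (k - Suc i)" "k - Suc (k - Suc i) = i" using that by auto
    then show ?thesis by (simp add: L_def)
  qed
  have finL: "finite_space (L i)" if i: "i \<in> {1..k}" for i
  proof -
    have "set_pmf (L i) \<subseteq> fst ` set_pmf (L i) \<times> snd ` set_pmf (L i)" by force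
    also have "\<dots> = set_pmf (sp X i) \<times> set_pmf (sp Y i)"
      using L(1,2)[OF i] by (metis set_map_pmf)
    finally have "set_pmf (L i) \<subseteq> set_pmf (sp X i) \<times> set_pmf (sp Y i)" .
    with XY i show ?thesis
      unfolding Prob_chain_def finite_space_def by (auto intro: finite_subset)
  qed
  define Z where "Z = \<lparr> sp = (\<lambda>i. map_pmf prod_encode (L i)),
    arr = (\<lambda>i z. prod_encode (map_prod (arr X i) (arr Y i) (prod_decode z))) \<rparr>"
  have "Z \<in> Prob_chain k"
    using finL step
    by (auto simp: Prob_chain_def Z_def reduction_def finite_space_map pmf.map_comp o_def
        simp flip: step)
  moreover have "diagram_morphism k (\<lambda>i. fst \<circ> prod_decode) Z X"
    using L by (auto simp: diagram_morphism_def Z_def reduction_def pmf.map_comp o_def AE_measure_pmf_iff)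
  moreover have "diagram_morphism k (\<lambda>i. snd \<circ> prod_decode) Z Y"
    using L by (auto simp: diagram_morphism_def Z_def reduction_def pmf.map_comp o_def AE_measure_pmf_iff)
  ultimately have "two_fan k X Z Y (\<lambda>i. fst \<circ> prod_decode) (\<lambda>i. snd \<circ> prod_decode)"
    by (simp add: two_fan_def)
  then show thesis
  proof (rule that)
    fix i assume i: "i \<in> {1..k}"
    have "Ent (sp Z i) = Ent (L i)"
      by (simp add: Z_def Ent_map_inj inj_prod_encode)
    also have "\<dots> \<le> max (Ent (sp X i)) (Ent (sp Y i))
       + sqrt (varent (sp X i)) + sqrt (varent (sp Y i)) + ln 2"
      using i M N by (intro Ent_comonotone_le[OF finL L(3) L(1,2)] inj_on_chain_rank) auto
    finally show "Ent (sp Z i) \<le> \<dots>" .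
  qed
qed

section \<open>Two-sided bounds on the intrinsic distance\<close>

lemma Ent_two_fan_ge:
  assumes "two_fan k X Z Y f g" "i \<in> {1..k}"
  shows "Ent (sp X i) \<le> Ent (sp Z i)" "Ent (sp Y i) \<le> Ent (sp Z i)"
proof -
  have "finite_space (sp Z i)" "map_pmf (f i) (sp Z i) = sp X i" "map_pmf (g i) (sp Z i) = sp Y i"
    using assms by (auto simp: two_fan_def Prob_chain_def diagram_morphism_def reduction_def)
  then show "Ent (sp X i) \<le> Ent (sp Z i)" "Ent (sp Y i) \<le> Ent (sp Z i)"
    using Ent_map_le[of "sp Z i" "f i"] Ent_map_le[of "sp Z i" "g i"] by simp_all
qed

text \<open>The legs are reductions, so the apex has the largest entropy at every level and the
  absolute values open.\<close>

lemma kd_eq: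
  assumes "two_fan k X Z Y f g"
  shows "kd k X Z Y = (\<Sum>i=1..k. 2 * Ent (sp Z i) - Ent (sp X i) - Ent (sp Y i))"
proof -
  have "kd k X Z Y = (\<Sum>i=1..k. \<bar>Ent (sp Z i) - Ent (sp X i)\<bar> + \<bar>Ent (sp Z i) - Ent (sp Y i)\<bar>)"
    by (simp add: kd_def l1_dist_def Ent_star_def sum.distrib)
  also have "\<dots> = (\<Sum>i=1..k. 2 * Ent (sp Z i) - Ent (sp X i) - Ent (sp Y i))"
    using Ent_two_fan_ge[OF assms] by (intro sum.cong) auto
  finally show ?thesis .
qed

lemma l1_dist_Ent_star_le_kd:
  assumes "two_fan k X Z Y f g"
  shows "l1_dist k (Ent_star k X) (Ent_star k Y) \<le> kd k X Z Y"
  unfolding kd_eq[OF assms] l1_dist_def Ent_star_def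
proof (rule sum_mono)
  fix i assume "i \<in> {1..k}"
  with Ent_two_fan_ge[OF assms this]
  show "\<bar>(\<lambda>i\<in>{1..k}. Ent (sp X i)) i - (\<lambda>i\<in>{1..k}. Ent (sp Y i)) i\<bar>
    \<le> 2 * Ent (sp Z i) - Ent (sp X i) - Ent (sp Y i)"
    by (simp add: abs_if)
qed

lemma intrinsic_dist_bounds:
  assumes "X \<in> Prob_chain k" "Y \<in> Prob_chain k" "1 \<le> k"
  shows "l1_dist k (Ent_star k X) (Ent_star k Y) \<le> intrinsic_dist k X Y" (is "?l \<le> _")
    and "intrinsic_dist k X Y \<le> l1_dist k (Ent_star k X) (Ent_star k Y)
      + 2 * (\<Sum>i=1..k. sqrt (varent (sp X i)) + sqrt (varent (sp Y i)) + ln 2)" (is "_ \<le> ?u")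
proof -
  let ?K = "{kd k X Z Y | Z f g. two_fan k X Z Y f g}"
  obtain Z f g where Z: "two_fan k X Z Y f g"
    "\<And>i. i \<in> {1..k} \<Longrightarrow> Ent (sp Z i) \<le> max (Ent (sp X i)) (Ent (sp Y i))
       + sqrt (varent (sp X i)) + sqrt (varent (sp Y i)) + ln 2"
    using two_fan_exists[OF assms] by blast
  have lb: "?l \<le> x" if "x \<in> ?K" for x
    using that l1_dist_Ent_star_le_kd by auto
  \<comment> \<open>The infimum is informative because its set is nonempty and bounded
    below.\<close>
  have in_K: "kd k X Z Y \<in> ?K" using Z(1) by auto
  show "?l \<le> intrinsic_dist k X Y"
    unfolding intrinsic_dist_def using in_K lb by (intro cInf_greatest) blast+
  have "intrinsic_dist k X Y \<le> kd k X Z Y"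
    unfolding intrinsic_dist_def using in_K lb by (intro cInf_lower bdd_belowI) blast+
  also have "\<dots> \<le> (\<Sum>i=1..k. \<bar>Ent_star k X i - Ent_star k Y i\<bar>
       + 2 * (sqrt (varent (sp X i)) + sqrt (varent (sp Y i)) + ln 2))"
    unfolding kd_eq[OF Z(1)]
  proof (rule sum_mono)
    \<comment> \<open>As \<open>2 * max a b - a - b = \<bar>a - b\<bar>\<close>, only the error
      terms of the apex entropy remain, counted twice.\<close>
    fix i assume i: "i \<in> {1..k}"
    with Z(2)[OF i] show "2 * Ent (sp Z i) - Ent (sp X i) - Ent (sp Y i)
      \<le> \<bar>Ent_star k X i - Ent_star k Y i\<bar>
       + 2 * (sqrt (varent (sp X i)) + sqrt (varent (sp Y i)) + ln 2)"
      unfolding Ent_star_def by (simp add: abs_if max_def split: if_splits)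
  qed
  also have "\<dots> = ?u"
    unfolding sum_distrib_left by (simp only: sum.distrib[symmetric] l1_dist_def)
  finally show "intrinsic_dist k X Y \<le> ?u" .
qed

section \<open>The asymptotic entropy distance\<close>

lemma neutral_in_Prob_chain: "neutral \<in> Prob_chain k"
  by (simp add: Prob_chain_def neutral_def finite_space_def reduction_def)

lemma tensor_in_Prob_chain:
  assumes "X \<in> Prob_chain k" "Y \<in> Prob_chain k"
  shows "tensor X Y \<in> Prob_chain k"
proof -
  have "map_pmf (arr (tensor X Y) i) (sp (tensor X Y) (Suc i)) = sp (tensor X Y) i"
    if "i \<in> {1..<k}" for i
  proof -
    have "map_pmf (arr (tensor X Y) i) (sp (tensor X Y) (Suc i))
      = map_pmf prod_encode (map_pmf (\<lambda>(a, b). (arr X i a, arr Y i b)) (pair_pmf (sp X (Suc i)) (sp Y (Suc i))))"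
      by (simp add: tensor_def pmf.map_comp o_def map_prod_def)
    also have "\<dots> = sp (tensor X Y) i"
      using assms that by (simp add: map_pair Prob_chain_def reduction_def tensor_def)
    finally show ?thesis .
  qed
  with assms show ?thesis
    by (auto simp: Prob_chain_def reduction_def tensor_def finite_space_map finite_space_pair)
qed

lemma tensor_power_in_Prob_chain: "X \<in> Prob_chain k \<Longrightarrow> tensor_power X n \<in> Prob_chain k"
  by (induction n) (auto simp: neutral_in_Prob_chain tensor_in_Prob_chain)

lemma
  assumes "X \<in> Prob_chain k" "Y \<in> Prob_chain k" "i \<in> {1..k}"
  shows Ent_tensor: "Ent (sp (tensor X Y) i) = Ent (sp X i) + Ent (sp Y i)"
    and varent_tensor: "varent (sp (tensor X Y) i) = varent (sp X i) + varent (sp Y i)"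
  using assms
  by (auto simp: tensor_def Ent_map_inj varent_map_inj inj_prod_encode Ent_pair varent_pair Prob_chain_def)

lemma
  shows Ent_neutral: "Ent (sp neutral i) = 0"
    and varent_neutral: "varent (sp neutral i) = 0"
  by (simp_all add: neutral_def Ent_def varent_def)

lemma
  assumes "X \<in> Prob_chain k" "i \<in> {1..k}"
  shows Ent_tensor_power: "Ent (sp (tensor_power X n) i) = real n * Ent (sp X i)"
    and varent_tensor_power: "varent (sp (tensor_power X n) i) = real n * varent (sp X i)"
  by (induction n)
     (use assms in \<open>auto simp: Ent_tensor varent_tensor tensor_power_in_Prob_chain algebra_simps
        Ent_neutral varent_neutral\<close>)

lemma l1_dist_Ent_star_tensor_power:
  assumes "X \<in> Prob_chain k" "Y \<in> Prob_chain k"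
  shows "l1_dist k (Ent_star k (tensor_power X n)) (Ent_star k (tensor_power Y n))
    = real n * l1_dist k (Ent_star k X) (Ent_star k Y)"
  unfolding l1_dist_def sum_distrib_left
  by (intro sum.cong refl)
     (use assms in \<open>auto simp: Ent_star_def Ent_tensor_power abs_mult simp flip: right_diff_distrib\<close>)

text \<open>Entropy and its variance are both linear in the tensor exponent: the distance scales by
  \<open>n\<close>, the error only by \<open>sqrt n\<close>, which division by \<open>n\<close>
  removes.\<close>

theorem kappa_eq_l1_dist:
  assumes "X \<in> Prob_chain k" "Y \<in> Prob_chain k" "1 \<le> k"
  shows "kappa k X Y = l1_dist k (Ent_star k X) (Ent_star k Y)" (is "_ = ?l")
proof -
  define A where "A = (\<Sum>i=1..k. sqrt (varent (sp X i)) + sqrt (varent (sp Y i)))"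
  let ?d = "\<lambda>n. intrinsic_dist k (tensor_power X n) (tensor_power Y n)"
  have pow: "tensor_power X n \<in> Prob_chain k" "tensor_power Y n \<in> Prob_chain k" for n
    using assms by (auto intro: tensor_power_in_Prob_chain)
  have lower: "real n * ?l \<le> ?d n" for n
    using intrinsic_dist_bounds(1)[OF pow assms(3), of n n] l1_dist_Ent_star_tensor_power assms by simp
  have upper: "?d n \<le> real n * ?l + 2 * (A * sqrt (real n) + real k * ln 2)" for n
  proof -
    have "(\<Sum>i=1..k. sqrt (varent (sp (tensor_power X n) i)) + sqrt (varent (sp (tensor_power Y n) i)) + ln 2)
      = (\<Sum>i=1..k. (sqrt (varent (sp X i)) + sqrt (varent (sp Y i))) * sqrt (real n) + ln 2)"
      using assms by (intro sum.cong refl) (simp add: varent_tensor_power real_sqrt_mult algebra_simps)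
    also have "\<dots> = A * sqrt (real n) + real k * ln 2"
      unfolding A_def sum_distrib_right by (subst sum.distrib) simp
    finally show ?thesis
      using intrinsic_dist_bounds(2)[OF pow assms(3), of n n]
        l1_dist_Ent_star_tensor_power[OF assms(1,2)] by simp
  qed
  have "(\<lambda>n. (1 / real n) * ?d n) \<longlonglongrightarrow> ?l"
  proof (rule tendsto_sandwich)
    \<comment> \<open>At \<open>n = 0\<close> the quotient is 0 by convention and this bound can
      fail, hence \<open>0 < n\<close>.\<close>
    have "?l \<le> (1 / real n) * ?d n" if "0 < n" for n
      using lower[of n] that by (simp add: field_simps)
    then show "\<forall>\<^sub>F n in sequentially. ?l \<le> (1 / real n) * ?d n"
      using eventually_gt_at_top[of "0 :: nat"] by (rule eventually_mono[rotated])
    have "(1 / real n) * ?d n \<le> ?l + 2 * (A * sqrt (real n) + real k * ln 2) / real n"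
      if "0 < n" for n
      using upper[of n] that by (simp add: field_simps)
    then show "\<forall>\<^sub>F n in sequentially. (1 / real n) * ?d n
        \<le> ?l + 2 * (A * sqrt (real n) + real k * ln 2) / real n"
      using eventually_gt_at_top[of "0 :: nat"] by (rule eventually_mono[rotated])
    show "(\<lambda>n. ?l + 2 * (A * sqrt (real n) + real k * ln 2) / real n) \<longlonglongrightarrow> ?l"
    proof -
      have "(\<lambda>n. l + 2 * (A * sqrt (real n) + B) / real n) \<longlonglongrightarrow> l" for l A B :: real
        by real_asymp
      then show ?thesis .
    qed
  qed simp
  then show ?thesis unfolding kappa_def by (rule limI)
qed

section \<open>Quasi-additive sequences and the tropical cone\<close>

text \<open>\<open>phi\<close> is multiplicative, so each doubling followed by halving contributes
  the ratio \<open>phi 2 / 2\<close>, which is below 1 by \<open>phi_2_less\<close>.\<close>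

lemma phi_power2_scale:
  assumes "0 \<le> t"
  shows "phi (2 ^ j * t) / 2 ^ j = phi t * (phi 2 / 2) ^ j"
  using assms by (induction j) (simp_all add: phi_def powr_mult field_simps)

lemma phi_2_less: "phi 2 / 2 < 1"
proof -
  have "phi 2 < 2 powr 1" unfolding phi_def by (intro powr_less_mono) auto
  then show ?thesis by simp
qed

lemma phi_nonneg: "0 \<le> phi t"
  by (simp add: phi_def)

text \<open>Along the powers of \<open>2\<close> the errors are summable, and the limit of the rescaled sequence is
  exactly additive.\<close>

lemma quasi_additive_limit:
  fixes e :: "nat \<Rightarrow> real"
  assumes e: "\<And>m n. 1 \<le> m \<Longrightarrow> 1 \<le> n \<Longrightarrow> \<bar>e (m + n) - (e m + e n)\<bar> \<le> C * phi (real (m + n))"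
  shows "convergent (\<lambda>n. e n / real n)"
proof -
  define q where "q = phi 2 / 2"
  define a where "a n j = e (2 ^ j * n) / 2 ^ j" for n j :: nat
  \<comment> \<open>\<open>1 / (1 - q)\<close> is the sum of the geometric series of errors along
    the doublings.\<close>
  define D where "D = C * (1 / (1 - q))"
  have q: "0 \<le> q" "q < 1" using phi_2_less by (auto simp: q_def phi_nonneg)
  \<comment> \<open>The instance \<open>m = n = 1\<close> forces \<open>C\<close> to be
    nonnegative.\<close>
  have "0 \<le> C * phi (real (1 + 1))" using e[of 1 1] by linarith
  moreover have "0 < phi (real (1 + 1))" by (simp add: phi_def)
  ultimately have C: "0 \<le> C" by (simp add: zero_le_mult_iff)
  have scale: "phi (real (2 ^ j * n)) / 2 ^ j = phi (real n) * q ^ j" for n j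
    using phi_power2_scale[of "real n" j] by (simp add: q_def)
  have step: "\<bar>a n (Suc j) - a n j\<bar> \<le> C * phi (real n) * q ^ j" if "1 \<le> n" for n j
  proof -
    have "1 \<le> 2 ^ j * n" using that by simp
    from e[OF this this]
    have "\<bar>e (2 ^ Suc j * n) - 2 * e (2 ^ j * n)\<bar> \<le> C * phi (real (2 ^ Suc j * n))"
      by (simp add: mult_2[symmetric] mult.assoc)
    then have "\<bar>e (2 ^ Suc j * n) - 2 * e (2 ^ j * n)\<bar> / 2 ^ Suc j \<le> C * (phi (real n) * q ^ Suc j)"
      unfolding scale[symmetric] by (simp add: divide_right_mono)
    moreover have "\<bar>a n (Suc j) - a n j\<bar> = \<bar>e (2 ^ Suc j * n) - 2 * e (2 ^ j * n)\<bar> / 2 ^ Suc j"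
    proof -
      have "a n (Suc j) - a n j = (e (2 ^ Suc j * n) - 2 * e (2 ^ j * n)) / 2 ^ Suc j"
        by (simp add: a_def diff_divide_distrib)
      then show ?thesis by (simp only: abs_divide) simp
    qed
    moreover have "C * (phi (real n) * q ^ Suc j) \<le> C * (phi (real n) * q ^ j)"
      using q C by (intro mult_left_mono) (auto simp: phi_nonneg mult_left_le_one_le)
    ultimately show ?thesis by simp
  qed
  have geom: "summable (\<lambda>j. C * phi (real n) * q ^ j)" for n
    using q by (intro summable_mult summable_geometric) simp
  have conv: "convergent (a n)" if "1 \<le> n" for n
  proof -
    have "summable (\<lambda>j. a n (Suc j) - a n j)"
      using step[OF that] by (intro summable_comparison_test'[OF geom[of n], of 0]) simp
    then have "convergent (\<lambda>N. \<Sum>j<N. a n (Suc j) - a n j)"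
      by (simp add: summable_iff_convergent)
    then have "convergent (\<lambda>N. a n N - a n 0)" by (simp add: sum_lessThan_telescope)
    then have "convergent (\<lambda>N. (a n N - a n 0) + a n 0)" by (intro convergent_add convergent_const)
    then show ?thesis by simp
  qed
  define L where "L n = lim (a n)" for n
  have L: "a n \<longlonglongrightarrow> L n" if "1 \<le> n" for n
    using conv[OF that] by (simp add: L_def convergent_LIMSEQ_iff)
  \<comment> \<open>Telescoping from \<open>a n 0 = e n\<close> and summing the geometric
    series.\<close>
  have bound: "\<bar>L n - e n\<bar> \<le> D * phi (real n)" if n: "1 \<le> n" for n
  proof (rule LIMSEQ_le_const2)
    show "(\<lambda>N. \<bar>a n N - e n\<bar>) \<longlonglongrightarrow> \<bar>L n - e n\<bar>"
      using L[OF n] by (intro tendsto_intros)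
    have "\<bar>a n N - e n\<bar> \<le> D * phi (real n)" for N
    proof -
      have "a n N - e n = (\<Sum>j<N. a n (Suc j) - a n j)"
        by (simp add: sum_lessThan_telescope) (simp add: a_def)
      also have "\<bar>\<dots>\<bar> \<le> (\<Sum>j<N. C * phi (real n) * q ^ j)"
        using step[OF n] by (intro order_trans[OF sum_abs] sum_mono)
      also have "\<dots> \<le> (\<Sum>j. C * phi (real n) * q ^ j)"
        using C q by (intro sum_le_suminf geom) (auto simp: phi_nonneg)
      also have "\<dots> = D * phi (real n)"
        using q by (subst suminf_mult) (auto simp: D_def suminf_geometric summable_geometric)
      finally show ?thesis .
    qed
    then show "\<exists>N. \<forall>n'\<ge>N. \<bar>a n n' - e n\<bar> \<le> D * phi (real n)" by blast
  qed
  \<comment> \<open>The additivity defect at scale \<open>2 ^ j\<close>, divided by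
    \<open>2 ^ j\<close>, decays like \<open>q ^ j\<close>.\<close>
  have add: "L (m + n) = L m + L n" if mn: "1 \<le> m" "1 \<le> n" for m n
  proof -
    have "(\<lambda>j. a (m + n) j - (a m j + a n j)) \<longlonglongrightarrow> 0"
    proof (rule Lim_null_comparison, unfold real_norm_def)
      show "\<forall>\<^sub>F j in sequentially. \<bar>a (m + n) j - (a m j + a n j)\<bar> \<le> C * phi (real (m + n)) * q ^ j"
      proof (rule always_eventually, rule allI)
        fix j
        have "\<bar>e (2 ^ j * m + 2 ^ j * n) - (e (2 ^ j * m) + e (2 ^ j * n))\<bar>
            \<le> C * phi (real (2 ^ j * m + 2 ^ j * n))"
          using mn by (intro e) auto
        then have "\<bar>e (2 ^ j * (m + n)) - (e (2 ^ j * m) + e (2 ^ j * n))\<bar> / 2 ^ j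
            \<le> C * (phi (real (m + n)) * q ^ j)"
          unfolding scale[symmetric] by (simp add: divide_right_mono distrib_left)
        moreover have "a (m + n) j - (a m j + a n j)
            = (e (2 ^ j * (m + n)) - (e (2 ^ j * m) + e (2 ^ j * n))) / 2 ^ j"
          by (simp add: a_def diff_divide_distrib add_divide_distrib)
        ultimately show "\<bar>a (m + n) j - (a m j + a n j)\<bar> \<le> C * phi (real (m + n)) * q ^ j"
          by (simp only: abs_divide) simp
      qed
      show "(\<lambda>j. C * phi (real (m + n)) * q ^ j) \<longlonglongrightarrow> 0"
        using q by (intro tendsto_mult_right_zero LIMSEQ_power_zero) simp
    qed
    moreover have "(\<lambda>j. a (m + n) j - (a m j + a n j)) \<longlonglongrightarrow> L (m + n) - (L m + L n)"
      using mn by (intro tendsto_intros L) auto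
    ultimately show ?thesis using LIMSEQ_unique by fastforce
  qed
  have lin: "L n = real n * L 1" if "1 \<le> n" for n
    using that
  proof (induction n rule: nat_induct_at_least)
    case (Suc n)
    then show ?case using add[of n 1] by (simp add: algebra_simps)
  qed simp
  have "(\<lambda>n. e n / real n) \<longlonglongrightarrow> L 1"
  proof (rule Lim_transform2)
    show "(\<lambda>n. L 1) \<longlonglongrightarrow> L 1" by simp
    \<comment> \<open>Since \<open>L n / n = L 1\<close> for positive \<open>n\<close>, the
      difference is at most \<open>D * phi n / n\<close>, and \<open>phi\<close> is
      sublinear.\<close>
    show "(\<lambda>n. L 1 - e n / real n) \<longlonglongrightarrow> 0"
    proof (rule Lim_null_comparison, unfold real_norm_def)
      show "\<forall>\<^sub>F n in sequentially. \<bar>L 1 - e n / real n\<bar> \<le> D * (real n powr (3/4) / real n)"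
        using eventually_ge_at_top[of 1]
      proof eventually_elim
        case (elim n)
        have "\<bar>L 1 - e n / real n\<bar> = \<bar>L n - e n\<bar> / real n"
        proof -
          have "L 1 - e n / real n = (L n - e n) / real n"
            using elim lin[OF elim] by (simp add: field_simps)
          then show ?thesis by (simp only: abs_divide abs_of_nat)
        qed
        also have "\<dots> \<le> D * phi (real n) / real n"
          using bound[OF elim] by (intro divide_right_mono) auto
        finally show ?case by (simp add: phi_def)
      qed
      have "(\<lambda>n. real n powr (3/4) / real n) \<longlonglongrightarrow> 0" by real_asymp
      then show "(\<lambda>n. D * (real n powr (3/4) / real n)) \<longlonglongrightarrow> 0"
        by (rule tendsto_mult_right_zero)
    qed
  qed
  then show ?thesis by (rule convergentI)
qed

section \<open>The entropy rate and the cone structure\<close>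

definition entropy_rate :: "nat \<Rightarrow> (nat \<Rightarrow> diagram) \<Rightarrow> nat \<Rightarrow> real" where
  "entropy_rate k X = (\<lambda>i\<in>{1..k}. lim (\<lambda>n. Ent (sp (X n) i) / real n))"

lemma entropy_rate_eqI:
  "i \<in> {1..k} \<Longrightarrow> (\<lambda>n. Ent (sp (X n) i) / real n) \<longlonglongrightarrow> l \<Longrightarrow> entropy_rate k X i = l"
  by (simp add: entropy_rate_def limI)

lemma Prob_trop_in_Prob_chain: "X \<in> Prob_trop k \<Longrightarrow> X n \<in> Prob_chain k"
  by (simp add: Prob_trop_def)

text \<open>By \<open>kappa_eq_l1_dist\<close> the defect of the sequence dominates each coordinate
  of its entropy defect, so every coordinate is quasi-additive.\<close>

lemma tendsto_entropy_rate:
  assumes X: "X \<in> Prob_trop k" and i: "i \<in> {1..k}" and k: "1 \<le> k"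
  shows "(\<lambda>n. Ent (sp (X n) i) / real n) \<longlonglongrightarrow> entropy_rate k X i"
proof -
  obtain C where C: "\<And>m n. 1 \<le> m \<Longrightarrow> 1 \<le> n \<Longrightarrow>
      kappa k (X (m + n)) (tensor (X m) (X n)) \<le> C * phi (real (m + n))"
    using X by (auto simp: Prob_trop_def)
  note X' = Prob_trop_in_Prob_chain[OF X]
  have "\<bar>Ent (sp (X (m + n)) i) - (Ent (sp (X m) i) + Ent (sp (X n) i))\<bar> \<le> C * phi (real (m + n))"
    if "1 \<le> m" "1 \<le> n" for m n
  proof -
    let ?T = "tensor (X m) (X n)"
    have "\<bar>Ent (sp (X (m + n)) i) - (Ent (sp (X m) i) + Ent (sp (X n) i))\<bar>
        = \<bar>Ent_star k (X (m + n)) i - Ent_star k ?T i\<bar>"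
      using i X' by (simp add: Ent_star_def Ent_tensor[of _ k])
    also have "\<dots> \<le> l1_dist k (Ent_star k (X (m + n))) (Ent_star k ?T)"
      unfolding l1_dist_def using i by (intro member_le_sum) auto
    also have "\<dots> = kappa k (X (m + n)) ?T"
      using X' k by (simp add: kappa_eq_l1_dist tensor_in_Prob_chain)
    finally show ?thesis using C[OF that] by linarith
  qed
  from quasi_additive_limit[of "\<lambda>n. Ent (sp (X n) i)", OF this] show ?thesis
    using i by (simp add: entropy_rate_def convergent_LIMSEQ_iff)
qed

lemma entropy_rate_in_K_cone:
  assumes X: "X \<in> Prob_trop k" and k: "1 \<le> k"
  shows "entropy_rate k X \<in> K_cone k"
proof -
  have "0 \<le> entropy_rate k X 1"
    using k by (intro LIMSEQ_le_const[OF tendsto_entropy_rate[OF X _ k]]) (auto simp: Ent_nonneg)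
  moreover have "entropy_rate k X i \<le> entropy_rate k X (Suc i)" if "i \<in> {1..<k}" for i
  proof (rule LIMSEQ_le[OF tendsto_entropy_rate[OF X _ k] tendsto_entropy_rate[OF X _ k]])
    have "Ent (sp (X n) i) \<le> Ent (sp (X n) (Suc i))" for n
      using Prob_trop_in_Prob_chain[OF X, of n] that Ent_map_le[of "sp (X n) (Suc i)" "arr (X n) i"]
      by (simp add: Prob_chain_def reduction_def)
    then show "\<exists>N. \<forall>n\<ge>N. Ent (sp (X n) i) / real n \<le> Ent (sp (X n) (Suc i)) / real n"
      by (simp add: divide_right_mono)
  qed (use that in auto)
  ultimately show ?thesis
    by (auto simp: K_cone_def Rvec_def entropy_rate_def)
qed

lemma entropy_rate_add:
  assumes "X \<in> Prob_trop k" "Y \<in> Prob_trop k" "1 \<le> k"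
  shows "entropy_rate k (trop_add X Y) = vec_add k (entropy_rate k X) (entropy_rate k Y)"
proof (rule ext)
  fix i
  show "entropy_rate k (trop_add X Y) i = vec_add k (entropy_rate k X) (entropy_rate k Y) i"
  proof (cases "i \<in> {1..k}")
    case True
    have "(\<lambda>n. Ent (sp (X n) i) / real n + Ent (sp (Y n) i) / real n)
        \<longlonglongrightarrow> entropy_rate k X i + entropy_rate k Y i"
      using assms True by (intro tendsto_add tendsto_entropy_rate)
    moreover have "Ent (sp (trop_add X Y n) i) = Ent (sp (X n) i) + Ent (sp (Y n) i)" for n
      using assms True by (simp add: trop_add_def Ent_tensor[of _ k] Prob_trop_in_Prob_chain)
    ultimately show ?thesis
      using True by (simp add: vec_add_def add_divide_distrib entropy_rate_eqI)
  qed (auto simp: entropy_rate_def vec_add_def)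
qed

lemma tendsto_nat_floor_mult_div:
  fixes c :: real
  assumes "0 \<le> c"
  shows "(\<lambda>n. real (nat \<lfloor>c * real n\<rfloor>) / real n) \<longlonglongrightarrow> c"
proof (rule tendsto_sandwich)
  have *: "c * real n - 1 \<le> real (nat \<lfloor>c * real n\<rfloor>)" "real (nat \<lfloor>c * real n\<rfloor>) \<le> c * real n" for n
    using assms by (simp_all add: of_nat_nat)
  have "c - 1 / real n \<le> real (nat \<lfloor>c * real n\<rfloor>) / real n"
    "real (nat \<lfloor>c * real n\<rfloor>) / real n \<le> c" if "0 < n" for n
    using divide_right_mono[OF *(1)[of n], of "real n"] divide_right_mono[OF *(2)[of n], of "real n"] that
    by (simp_all add: diff_divide_distrib)
  then show "\<forall>\<^sub>F n in sequentially. c - 1 / real n \<le> real (nat \<lfloor>c * real n\<rfloor>) / real n"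
    "\<forall>\<^sub>F n in sequentially. real (nat \<lfloor>c * real n\<rfloor>) / real n \<le> c"
    by (auto intro: eventually_mono[OF eventually_gt_at_top[of 0]])
  show "(\<lambda>n. c - 1 / real n) \<longlonglongrightarrow> c" by real_asymp
qed simp

lemma entropy_rate_scale:
  assumes X: "X \<in> Prob_trop k" and k: "1 \<le> k" and c: "0 \<le> c"
  shows "entropy_rate k (trop_scale c X) = vec_scale k c (entropy_rate k X)"
proof (rule ext)
  fix i
  show "entropy_rate k (trop_scale c X) i = vec_scale k c (entropy_rate k X) i"
  proof (cases "i \<in> {1..k}")
    case i: True
    define e where "e n = Ent (sp (X n) i)" for n
    define m where "m n = nat \<lfloor>c * real n\<rfloor>" for n
    have "(\<lambda>n. e (m n) / real n) \<longlonglongrightarrow> c * entropy_rate k X i"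
    proof (cases "c = 0")
      case True
      then have "(\<lambda>n. e (m n) / real n) = (\<lambda>n. e 0 / real n)" by (simp add: m_def)
      also have "\<dots> \<longlonglongrightarrow> 0" by real_asymp
      finally show ?thesis using True by simp
    next
      case False
      with c have "filterlim (\<lambda>n. c * real n) at_top sequentially" by real_asymp
      then have m: "filterlim m at_top sequentially"
        unfolding m_def
        by (intro filterlim_compose[OF filterlim_nat_sequentially]
            filterlim_compose[OF filterlim_floor_sequentially])
      have "(\<lambda>n. e (m n) / real (m n)) \<longlonglongrightarrow> entropy_rate k X i"
        using filterlim_compose[OF tendsto_entropy_rate[OF X i k] m] by (simp add: e_def)
      \<comment> \<open>The quotient is split at \<open>m n\<close>: the first factor tends to
        \<open>c\<close>, the second to the entropy rate. Cancelling needs \<open>m n > 0\<close>,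
        which holds eventually.\<close>
      then have "(\<lambda>n. (real (m n) / real n) * (e (m n) / real (m n))) \<longlonglongrightarrow> c * entropy_rate k X i"
        unfolding m_def by (intro tendsto_mult tendsto_nat_floor_mult_div c)
      moreover have "\<forall>\<^sub>F n in sequentially. (real (m n) / real n) * (e (m n) / real (m n)) = e (m n) / real n"
        using eventually_gt_at_top[of 0, THEN eventually_compose_filterlim, OF m]
        by eventually_elim (simp add: field_simps)
      ultimately show ?thesis by (rule Lim_transform_eventually)
    qed
    with i show ?thesis
      by (simp add: vec_scale_def entropy_rate_eqI trop_scale_def e_def m_def)
  qed (auto simp: entropy_rate_def vec_scale_def)
qed

text \<open>By \<open>kappa_eq_l1_dist\<close> the rescaled distance is a continuous function of the
  rescaled entropies and converges with them.\<close>

lemma l1_dist_entropy_rate: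
  assumes X: "X \<in> Prob_trop k" and Y: "Y \<in> Prob_trop k" and k: "1 \<le> k"
  shows "l1_dist k (entropy_rate k X) (entropy_rate k Y) = kappa_hat k X Y"
proof -
  have "(1 / real n) * kappa k (X n) (Y n)
      = (\<Sum>i=1..k. \<bar>Ent (sp (X n) i) / real n - Ent (sp (Y n) i) / real n\<bar>)" for n
    using Prob_trop_in_Prob_chain[OF X] Prob_trop_in_Prob_chain[OF Y] k
    by (auto simp: kappa_eq_l1_dist l1_dist_def Ent_star_def sum_divide_distrib
        simp flip: diff_divide_distrib intro!: sum.cong)
  moreover have "(\<lambda>n. \<Sum>i=1..k. \<bar>Ent (sp (X n) i) / real n - Ent (sp (Y n) i) / real n\<bar>)
      \<longlonglongrightarrow> (\<Sum>i=1..k. \<bar>entropy_rate k X i - entropy_rate k Y i\<bar>)"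
    by (intro tendsto_intros tendsto_entropy_rate X Y k)
  ultimately show ?thesis
    by (simp add: kappa_hat_def l1_dist_def limI)
qed

section \<open>Realising the points of the cone by uniform spaces\<close>

lemma Ent_pmf_of_set:
  assumes "finite A" "A \<noteq> {}"
  shows "Ent (pmf_of_set A) = ln (real (card A))"
  using assms by (simp add: Ent_def ln_div)

text \<open>Writing \<open>z\<close> uniquely as \<open>x + a * y\<close> identifies the uniform
  space with a product of uniform spaces, and \<open>mod a\<close> is its first projection.\<close>

lemma map_pmf_mod_uniform:
  assumes "0 < a" "0 < (b :: nat)"
  shows "map_pmf (\<lambda>z. z mod a) (pmf_of_set {..<a * b}) = pmf_of_set {..<a}"
proof -
  have lt: "x + a * y < a * b" if "x < a" "y < b" for x y
  proof -
    have "a * (y + 1) \<le> a * b" using that by (intro mult_left_mono) auto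
    with that show ?thesis by simp
  qed
  have "bij_betw (\<lambda>(x, y). x + a * y) ({..<a} \<times> {..<b}) {..<a * b}"
    by (rule bij_betw_byWitness[where f' = "\<lambda>z. (z mod a, z div a)"])
       (use assms lt in \<open>auto simp: less_mult_imp_div_less mult.commute[of a b]\<close>)
  then have "pmf_of_set {..<a * b} = map_pmf (\<lambda>(x, y). x + a * y) (pmf_of_set ({..<a} \<times> {..<b}))"
    using assms by (subst map_pmf_of_set_bij_betw) auto
  also have "map_pmf (\<lambda>z. z mod a) \<dots> = map_pmf fst (pmf_of_set ({..<a} \<times> {..<b}))"
    unfolding pmf.map_comp
    by (rule map_pmf_cong[OF refl], subst (asm) set_pmf_of_set) (use assms in auto)
  also have "pmf_of_set ({..<a} \<times> {..<b}) = pair_pmf (pmf_of_set {..<a}) (pmf_of_set {..<b})"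
    using assms
    by (intro pmf_eqI) (auto simp: pmf_pair pmf_of_set[of "{..<a}"] pmf_of_set[of "{..<b}"]
        pmf_of_set[of "{..<a} \<times> {..<b}"] lessThan_empty_iff indicator_def)
  finally show ?thesis by (simp add: map_fst_pair_pmf)
qed

text \<open>The rescaled vector \<open>n \<cdot> x\<close> is realised, up to a bounded error, by uniform spaces whose
  cardinalities are products of the integers \<open>\<lceil>exp (n \<cdot> (x j - x (j - 1)))\<rceil>\<close>, with \<open>x 0\<close> read as \<open>0\<close>.\<close>

definition cone_increment :: "(nat \<Rightarrow> real) \<Rightarrow> nat \<Rightarrow> real" where
  "cone_increment x j = (if j = 1 then x 1 else x j - x (j - 1))"

definition uniform_size :: "(nat \<Rightarrow> real) \<Rightarrow> nat \<Rightarrow> nat \<Rightarrow> nat" where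
  "uniform_size x n i = (\<Prod>j=1..i. nat \<lceil>exp (real n * cone_increment x j)\<rceil>)"

definition uniform_chain :: "(nat \<Rightarrow> real) \<Rightarrow> nat \<Rightarrow> diagram" where
  "uniform_chain x n = \<lparr> sp = (\<lambda>i. pmf_of_set {..<uniform_size x n i}),
     arr = (\<lambda>i z. z mod uniform_size x n i) \<rparr>"

lemma uniform_size_pos: "0 < uniform_size x n i"
  by (auto simp: uniform_size_def intro!: prod_pos)

text \<open>Each size divides the next, so residues of a uniform point are uniform.\<close>

lemma uniform_chain_in_Prob_chain: "uniform_chain x n \<in> Prob_chain k"
proof -
  have "finite_space (pmf_of_set {..<uniform_size x n i})" for i
    using uniform_size_pos[of x n i] by (subst finite_space_def, subst set_pmf_of_set) auto
  moreover have "map_pmf (\<lambda>z. z mod uniform_size x n i) (pmf_of_set {..<uniform_size x n (Suc i)})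
      = pmf_of_set {..<uniform_size x n i}" for i
  proof -
    have "uniform_size x n (Suc i)
        = uniform_size x n i * nat \<lceil>exp (real n * cone_increment x (Suc i))\<rceil>"
      by (simp add: uniform_size_def)
    then show ?thesis by (simp add: map_pmf_mod_uniform uniform_size_pos)
  qed
  ultimately show ?thesis by (simp add: Prob_chain_def uniform_chain_def reduction_def)
qed

lemma sum_cone_increment: "1 \<le> i \<Longrightarrow> (\<Sum>j=1..i. cone_increment x j) = x i"
  by (induction i rule: nat_induct_at_least) (auto simp: cone_increment_def)

text \<open>Rounding up adds at most 1, which is at most \<open>exp t\<close>, so the value at most
  doubles.\<close>

lemma ln_nat_ceiling_exp:
  fixes t :: real
  assumes "0 \<le> t"
  shows "\<bar>ln (real (nat \<lceil>exp t\<rceil>)) - t\<bar> \<le> ln 2"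
proof -
  define N where "N = real (nat \<lceil>exp t\<rceil>)"
  have N: "exp t \<le> N" "N \<le> exp t + 1" by (simp_all add: N_def real_nat_ceiling_ge)
  moreover have "1 \<le> exp t" using assms by simp
  ultimately have "ln (exp t) \<le> ln N" "ln N \<le> ln (2 * exp t)"
    by (subst ln_le_cancel_iff; simp; linarith)+
  then show ?thesis by (simp add: ln_mult N_def)
qed

text \<open>Each of the \<open>i \<le> k\<close> factors contributes a rounding error of at most
  \<open>ln 2\<close>, whatever \<open>n\<close> is; the exact exponents telescope to
  \<open>n * x i\<close>.\<close>

lemma Ent_uniform_chain:
  assumes x: "x \<in> K_cone k" and i: "i \<in> {1..k}"
  shows "\<bar>Ent (sp (uniform_chain x n) i) - real n * x i\<bar> \<le> real k * ln 2"
proof -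
  let ?N = "\<lambda>j. real (nat \<lceil>exp (real n * cone_increment x j)\<rceil>)"
  \<comment> \<open>Membership in the cone makes the increments nonnegative, as the rounding bound
    requires.\<close>
  have nonneg: "0 \<le> cone_increment x j" if "j \<in> {1..i}" for j
  proof (cases "j = 1")
    case False
    with that i have "j - 1 \<in> {1..<k}" "Suc (j - 1) = j" by auto
    with x False show ?thesis unfolding K_cone_def cone_increment_def by fastforce
  qed (use x in \<open>auto simp: K_cone_def cone_increment_def\<close>)
  have N_nonzero: "?N j \<noteq> 0" for j
    using less_le_trans[OF exp_gt_zero real_nat_ceiling_ge] by (rule less_imp_neq[symmetric])
  have "Ent (sp (uniform_chain x n) i) = ln (real (uniform_size x n i))"
    using uniform_size_pos[of x n i] by (simp add: uniform_chain_def Ent_pmf_of_set lessThan_empty_iff)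
  also have "\<dots> = (\<Sum>j=1..i. ln (?N j))"
    unfolding uniform_size_def of_nat_prod
    by (intro ln_prod N_nonzero) simp
  finally have "Ent (sp (uniform_chain x n) i) - real n * x i
      = (\<Sum>j=1..i. ln (?N j) - real n * cone_increment x j)"
    using sum_cone_increment[of i x] i by (simp add: sum_subtractf sum_distrib_left[symmetric])
  also have "\<bar>\<dots>\<bar> \<le> (\<Sum>j=1..i. ln 2)"
    using nonneg by (intro order_trans[OF sum_abs] sum_mono ln_nat_ceiling_exp mult_nonneg_nonneg) auto
  also have "\<dots> \<le> real k * ln 2" using i by simp
  finally show ?thesis .
qed

text \<open>Three rounding errors per level bound the defect by a constant, which is absorbed
  because \<open>phi\<close> is at least 1 from 1 on.\<close>

lemma uniform_chain_in_Prob_trop: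
  assumes x: "x \<in> K_cone k" and k: "1 \<le> k"
  shows "uniform_chain x \<in> Prob_trop k"
proof -
  let ?U = "uniform_chain x" and ?b = "real k * ln 2"
  \<comment> \<open>At \<open>n = 0\<close> every factor is the ceiling of \<open>exp 0 = 1\<close>,
    so all spaces are single points.\<close>
  have "uniform_size x 0 i = 1" for i by (simp add: uniform_size_def)
  then have "sp (?U 0) i = return_pmf 0" for i
    by (simp add: uniform_chain_def lessThan_Suc pmf_of_set_singleton)
  then have iso: "diagram_iso k (?U 0) neutral"
    unfolding diagram_iso_def
    by (intro exI[of _ "\<lambda>_ _. 0"])
       (auto simp: diagram_morphism_def neutral_def reduction_def AE_measure_pmf_iff
          \<open>\<And>i. uniform_size x 0 i = 1\<close> uniform_chain_def)
  have "kappa k (?U (m + n)) (tensor (?U m) (?U n)) \<le> real k * (3 * ?b) * phi (real (m + n))"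
    if "1 \<le> m" "1 \<le> n" for m n
  proof -
    have "kappa k (?U (m + n)) (tensor (?U m) (?U n))
        = l1_dist k (Ent_star k (?U (m + n))) (Ent_star k (tensor (?U m) (?U n)))"
      using k by (simp add: kappa_eq_l1_dist tensor_in_Prob_chain uniform_chain_in_Prob_chain)
    also have "\<dots> \<le> (\<Sum>i=1..k. 3 * ?b)"
      unfolding l1_dist_def
    proof (rule sum_mono)
      fix i assume i: "i \<in> {1..k}"
      then have "\<bar>Ent_star k (?U (m + n)) i - Ent_star k (tensor (?U m) (?U n)) i\<bar>
        = \<bar>Ent (sp (?U (m + n)) i) - (Ent (sp (?U m) i) + Ent (sp (?U n) i))\<bar>"
        by (simp add: Ent_star_def Ent_tensor[of _ k] uniform_chain_in_Prob_chain)
      also have "\<dots> = \<bar>(Ent (sp (?U (m + n)) i) - real (m + n) * x i)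
          - (Ent (sp (?U m) i) - real m * x i) - (Ent (sp (?U n) i) - real n * x i)\<bar>"
        by (simp add: algebra_simps)
      also have "\<dots> \<le> 3 * ?b"
        using Ent_uniform_chain[OF x i, of "m + n"] Ent_uniform_chain[OF x i, of m]
          Ent_uniform_chain[OF x i, of n] by linarith
      finally show "\<bar>Ent_star k (?U (m + n)) i - Ent_star k (tensor (?U m) (?U n)) i\<bar> \<le> 3 * ?b" .
    qed
    also have "\<dots> = real k * (3 * ?b) * 1" by simp
    also have "\<dots> \<le> real k * (3 * ?b) * phi (real (m + n))"
      using that by (intro mult_left_mono) (auto simp: phi_def intro!: ge_one_powr_ge_zero)
    finally show ?thesis .
  qed
  then show ?thesis
    unfolding Prob_trop_def using iso
    by (auto simp: uniform_chain_in_Prob_chain intro!: exI[of _ "real k * (3 * ?b)"])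
qed

lemma entropy_rate_uniform_chain:
  assumes x: "x \<in> K_cone k"
  shows "entropy_rate k (uniform_chain x) = x"
proof (rule ext)
  fix i
  show "entropy_rate k (uniform_chain x) i = x i"
  proof (cases "i \<in> {1..k}")
    case i: True
    have "(\<lambda>n. x i - Ent (sp (uniform_chain x n) i) / real n) \<longlonglongrightarrow> 0"
    proof (rule Lim_null_comparison, unfold real_norm_def)
      show "\<forall>\<^sub>F n in sequentially. \<bar>x i - Ent (sp (uniform_chain x n) i) / real n\<bar>
          \<le> real k * ln 2 / real n"
        using eventually_gt_at_top[of 0]
      proof eventually_elim
        case (elim n)
        have "x i - Ent (sp (uniform_chain x n) i) / real n
          = - (Ent (sp (uniform_chain x n) i) - real n * x i) / real n"
          using elim by (simp add: field_simps)
        with Ent_uniform_chain[OF x i, of n] show ?case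
          by (simp only: abs_divide abs_minus_cancel) (simp add: divide_right_mono)
      qed
      have "(\<lambda>n. b / real n) \<longlonglongrightarrow> 0" for b :: real by real_asymp
      then show "(\<lambda>n. real k * ln 2 / real n) \<longlonglongrightarrow> 0" .
    qed
    then have "(\<lambda>n. Ent (sp (uniform_chain x n) i) / real n) \<longlonglongrightarrow> x i"
      by (rule Lim_transform2[OF tendsto_const])
    with i show ?thesis by (rule entropy_rate_eqI)
  next
    case False
    then have "x i = undefined" using x by (auto simp: K_cone_def Rvec_def PiE_def extensional_def)
    with False show ?thesis by (auto simp: entropy_rate_def)
  qed
qed

theorem theorem6p1:
  fixes k :: nat
  assumes "k \<ge> 1"
  shows "\<exists>\<Phi> :: (nat \<Rightarrow> diagram) \<Rightarrow> (nat \<Rightarrow> real).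
           \<Phi> ` Prob_trop k = K_cone k \<and>
           (\<forall>X\<in>Prob_trop k. \<forall>Y\<in>Prob_trop k. \<Phi> (trop_add X Y) = vec_add k (\<Phi> X) (\<Phi> Y)) \<and>
           (\<forall>X\<in>Prob_trop k. \<forall>c\<ge>0. \<Phi> (trop_scale c X) = vec_scale k c (\<Phi> X)) \<and>
           (\<forall>X\<in>Prob_trop k. \<forall>Y\<in>Prob_trop k. l1_dist k (\<Phi> X) (\<Phi> Y) = kappa_hat k X Y)"
proof (intro exI[of _ "entropy_rate k"] conjI ballI allI impI equalityI subsetI)
  fix x assume "x \<in> K_cone k"
  then show "x \<in> entropy_rate k ` Prob_trop k"
    using assms entropy_rate_uniform_chain uniform_chain_in_Prob_trop by (metis imageI)
qed (use assms in \<open>auto simp: entropy_rate_in_K_cone entropy_rate_add entropy_rate_scale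
      l1_dist_entropy_rate\<close>)

end
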